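(* Let $n,m\ge 1$. For every $[n]$-decorated $(m+1)$-ary tree $T$ of Shi type there exists a unique face $\Psi(T)$ of the $m$-Shi arrangement in $\mathbb{R}^n$ consisting of exactly the points $p=(p_1,\dots,p_n)\in\mathbb{R}^n$ satisfying: (1) for all $i,j\in[n]$, $p_i\le p_j$ iff $v_T(i)\preceq_T v_T(j)$; (2) for all $i,j\in[n]$ and $s\in[1,m-1]$, $p_i<p_j+s$ iff $v_T(i)\prec_T v^s_T(j)$; (3) for all $i<j$ in $[n]$, $p_i<p_j+m$ iff $v_T(i)\prec_T v^m_T(j)$; (4) for all $i,j\in[n]$ and $s\in[1,m-1]$, $p_i=p_j+s$ iff $v_T(i)=\mathrm{nextlive}(v^s_T(j))$ and there is a dashed path from $v_T(j)$ to $v_T(i)$; (5) for all $i<j$ in $[n]$, $p_i=p_j+m$ iff $v_T(i)=\mathrm{nextlive}(v^m_T(j))$ and there is a dashed path from $v_T(j)$ to $v_T(i)$. The map $T\mapsto\Psi(T)$ is a bijection from the set of $[n]$-decorated $(m+1)$-ary trees of Shi type to the set of faces of the $m$-Shi arrangement in $\mathbb{R}^n$. Moreover, such a $T$ has exactly $k$ free nodes if and only if $\Psi(T)$ has dimension $k$.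
   Context: $[n]=\{1,\dots,n\}$, $[a,b]=\{a,\dots,b\}$. A face of a finite arrangement of affine hyperplanes in $\mathbb{R}^n$ is a nonempty set obtained by choosing, for each hyperplane $\{a\cdot x=c\}$, one of $a\cdot x<c$, $=c$, $>c$ and taking the solution set; its dimension is that of its affine span. The $m$-Shi arrangement in $\mathbb{R}^n$ consists of the hyperplanes $x_i-x_j=s$ for $1\le i<j\le n$ and $s\in[-m+1,m]$. An $(m+1)$-ary tree is a rooted plane tree in which every vertex has $m+1$ or $0$ children; childless vertices are leaves, others nodes. The rank of a non-root vertex is the number of its siblings preceding it (children of a node have ranks $0,\dots,m$). An internal edge joins two nodes. If a node $v$ has a child of rank $>0$ that is a node, its cadet is the highest-rank such child and the edge to it is a cadet edge. An $[n]$-decorated $(m+1)$-ary tree is an $(m+1)$-ary tree whose nodes are labeled by nonempty subsets of $[n]$ forming a set partition of $[n]$, with each cadet edge declared solid or dashed (all other edges solid). An internal edge is a descent if $\max A>\min B$ ($A$ the parent's label, $B$ the child's label); the tree is of Shi type if every internal edge whose child has rank $m$ is a descent. A captive node is a node joined to its parent by a dashed edge; a free node is a node that is not captive. A dead leaf is a leaf having a sibling of smaller rank that is a captive node; other vertices are live. $\rho(v)$ is the word in $\{E_0,\dots,E_m\}$ recording the ranks of the edges on the root-to-$v$ path, $\dot\rho(v)$ the sum of those ranks. For distinct $v,w$: $v\prec_T w$ iff $\dot\rho(v)<\dot\rho(w)$, or $\dot\rho(v)=\dot\rho(w)$ and either $\rho(v)$ is a proper prefix of $\rho(w)$ or at the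 first differing position $\rho(v)$ has $E_b$ and $\rho(w)$ has $E_a$ with $a<b$; $\preceq_T$ is $\prec_T$ or equality. $v_T(i)$ is the node whose label contains $i$, $v^s_T(i)$ its child of rank $s$; $\mathrm{nextlive}(v)$ is the $\prec_T$-smallest live vertex $w$ with $v\preceq_T w$. A dashed path from node $u$ to node $w$ means $w$ is a descendant of $u$ and all edges on the path from $u$ down to $w$ are dashed. *)

theory Defs
  imports "HOL-Analysis.Analysis" "HOL-Library.Sublist"
begin

section \<open>Faces of a hyperplane arrangement\<close>

text \<open>
  An arrangement is a set of pairs \<open>(a, c)\<close>, each standing for the hyperplane \<open>a \<bullet> x = c\<close>.
  The set \<open>[n]\<close> is represented by a finite linearly ordered type \<open>'n\<close> with \<open>n = CARD('n)\<close>.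
\<close>

datatype side = Below | On | Above

fun on_side :: "side \<Rightarrow> 'v::euclidean_space \<times> real \<Rightarrow> 'v \<Rightarrow> bool" where
  "on_side Below (a, c) x \<longleftrightarrow> a \<bullet> x < c"
| "on_side On (a, c) x \<longleftrightarrow> a \<bullet> x = c"
| "on_side Above (a, c) x \<longleftrightarrow> a \<bullet> x > c"

definition faces :: "('v::euclidean_space \<times> real) set \<Rightarrow> 'v set set" where
  "faces H = {F. F \<noteq> {} \<and> (\<exists>\<sigma>. F = {x. \<forall>h\<in>H. on_side (\<sigma> h) h x})}"

definition shi_arrangement :: "nat \<Rightarrow> ((real^'n::{finite,linorder}) \<times> real) set" where
  "shi_arrangement m =
     {(axis i 1 - axis j 1, real_of_int s) | i j s. i < j \<and> s \<in> {- int m + 1..int m}}"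


section \<open>Decorated trees\<close>

text \<open>
  The Boolean at a node records whether its cadet edge is dashed; \<open>decorated\<close> below
  forces it to be \<open>False\<close> at nodes without a cadet.
\<close>

datatype 'a dtree = Leaf | Node "'a set" bool "'a dtree list"

text \<open>A vertex \<open>v\<close> is represented by the word \<open>\<rho>(v)\<close>, i.e. the list of ranks on its root path.\<close>

type_synonym vertex = "nat list"

fun subtree :: "'a dtree \<Rightarrow> vertex \<Rightarrow> 'a dtree option" where
  "subtree t [] = Some t"
| "subtree Leaf (r # v) = None"
| "subtree (Node A d ts) (r # v) = (if r < length ts then subtree (ts ! r) v else None)"

definition is_vertex :: "'a dtree \<Rightarrow> vertex \<Rightarrow> bool" where
  "is_vertex T v \<longleftrightarrow> subtree T v \<noteq> None"

definition is_leaf :: "'a dtree \<Rightarrow> vertex \<Rightarrow> bool" where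
  "is_leaf T v \<longleftrightarrow> subtree T v = Some Leaf"

definition is_node :: "'a dtree \<Rightarrow> vertex \<Rightarrow> bool" where
  "is_node T v \<longleftrightarrow> (\<exists>A d ts. subtree T v = Some (Node A d ts))"

definition label :: "'a dtree \<Rightarrow> vertex \<Rightarrow> 'a set" where
  "label T v = (case subtree T v of Some (Node A d ts) \<Rightarrow> A | _ \<Rightarrow> {})"

definition is_cadet :: "'a dtree \<Rightarrow> vertex \<Rightarrow> nat \<Rightarrow> bool" where
  "is_cadet T v r \<longleftrightarrow> r > 0 \<and> is_node T (v @ [r]) \<and> (\<forall>r'>r. \<not> is_node T (v @ [r']))"

definition dashed_edge :: "'a dtree \<Rightarrow> vertex \<Rightarrow> nat \<Rightarrow> bool" where
  "dashed_edge T v r \<longleftrightarrow> is_cadet T v r \<and> (\<exists>A ts. subtree T v = Some (Node A True ts))"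

definition ary_tree :: "nat \<Rightarrow> 'a dtree \<Rightarrow> bool" where
  "ary_tree k T \<longleftrightarrow> (\<forall>v A d ts. subtree T v = Some (Node A d ts) \<longrightarrow> length ts = k)"

definition decorated :: "nat \<Rightarrow> 'n dtree \<Rightarrow> bool" where
  "decorated m T \<longleftrightarrow>
     ary_tree (m + 1) T \<and>
     (\<forall>v. is_node T v \<longrightarrow> label T v \<noteq> {}) \<and>
     (\<forall>v w. is_node T v \<and> is_node T w \<and> v \<noteq> w \<longrightarrow> label T v \<inter> label T w = {}) \<and>
     (\<Union>v\<in>{v. is_node T v}. label T v) = UNIV \<and>
     (\<forall>v A ts. subtree T v = Some (Node A True ts) \<longrightarrow> (\<exists>r. is_cadet T v r))"

definition descent :: "'n::linorder dtree \<Rightarrow> vertex \<Rightarrow> nat \<Rightarrow> bool" where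
  "descent T v r \<longleftrightarrow> Max (label T v) > Min (label T (v @ [r]))"

definition shi_type :: "nat \<Rightarrow> 'n::linorder dtree \<Rightarrow> bool" where
  "shi_type m T \<longleftrightarrow> (\<forall>v. is_node T (v @ [m]) \<longrightarrow> descent T v m)"

definition shi_trees :: "nat \<Rightarrow> 'n::{finite,linorder} dtree set" where
  "shi_trees m = {T. decorated m T \<and> shi_type m T}"

definition captive :: "'a dtree \<Rightarrow> vertex \<Rightarrow> bool" where
  "captive T w \<longleftrightarrow> (\<exists>v r. w = v @ [r] \<and> is_node T w \<and> dashed_edge T v r)"

definition free_node :: "'a dtree \<Rightarrow> vertex \<Rightarrow> bool" where
  "free_node T v \<longleftrightarrow> is_node T v \<and> \<not> captive T v"

definition dead_leaf :: "'a dtree \<Rightarrow> vertex \<Rightarrow> bool" where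
  "dead_leaf T w \<longleftrightarrow> is_leaf T w \<and> (\<exists>v r r'. w = v @ [r] \<and> r' < r \<and> captive T (v @ [r']))"

definition live :: "'a dtree \<Rightarrow> vertex \<Rightarrow> bool" where
  "live T v \<longleftrightarrow> is_vertex T v \<and> \<not> dead_leaf T v"

text \<open>
  Since vertices are words, the orders \<open>\<prec>\<^sub>T\<close> and \<open>\<preceq>\<^sub>T\<close> do not mention the tree:
  they are restrictions of orders on all words. Among words of equal sum, the one with the
  larger letter at the first difference comes first.
\<close>

definition vless :: "vertex \<Rightarrow> vertex \<Rightarrow> bool" where
  "vless v w \<longleftrightarrow>
     sum_list v < sum_list w \<or>
     sum_list v = sum_list w \<and>
       (strict_prefix v w \<or> (\<exists>u a b v' w'. v = u @ b # v' \<and> w = u @ a # w' \<and> a < b))"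

definition vleq :: "vertex \<Rightarrow> vertex \<Rightarrow> bool" where
  "vleq v w \<longleftrightarrow> vless v w \<or> v = w"

definition node_of :: "'a dtree \<Rightarrow> 'a \<Rightarrow> vertex" where
  "node_of T i = (THE v. is_node T v \<and> i \<in> label T v)"

definition child_of :: "'a dtree \<Rightarrow> nat \<Rightarrow> 'a \<Rightarrow> vertex" where
  "child_of T s i = node_of T i @ [s]"

definition nextlive :: "'a dtree \<Rightarrow> vertex \<Rightarrow> vertex" where
  "nextlive T v = (THE w. live T w \<and> vleq v w \<and> (\<forall>w'. live T w' \<and> vleq v w' \<longrightarrow> vleq w w'))"

definition dashed_path :: "'a dtree \<Rightarrow> vertex \<Rightarrow> vertex \<Rightarrow> bool" where
  "dashed_path T u w \<longleftrightarrow>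
     is_node T u \<and> is_node T w \<and>
     (\<exists>x. w = u @ x \<and> (\<forall>k<length x. dashed_edge T (u @ take k x) (x ! k)))"


section \<open>The face associated with a tree\<close>

definition tree_point :: "nat \<Rightarrow> 'n::{finite,linorder} dtree \<Rightarrow> real^'n::{finite,linorder} \<Rightarrow> bool" where
  "tree_point m T p \<longleftrightarrow>
     (\<forall>i j. p $ i \<le> p $ j \<longleftrightarrow> vleq (node_of T i) (node_of T j)) \<and>
     (\<forall>i j. \<forall>s\<in>{1..m - 1}.
        p $ i < p $ j + real s \<longleftrightarrow> vless (node_of T i) (child_of T s j)) \<and>
     (\<forall>i j. i < j \<longrightarrow>
        (p $ i < p $ j + real m \<longleftrightarrow> vless (node_of T i) (child_of T m j))) \<and>
     (\<forall>i j. \<forall>s\<in>{1..m - 1}.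
        p $ i = p $ j + real s \<longleftrightarrow>
          node_of T i = nextlive T (child_of T s j) \<and> dashed_path T (node_of T j) (node_of T i)) \<and>
     (\<forall>i j. i < j \<longrightarrow>
        (p $ i = p $ j + real m \<longleftrightarrow>
          node_of T i = nextlive T (child_of T m j) \<and> dashed_path T (node_of T j) (node_of T i)))"

definition Psi :: "nat \<Rightarrow> 'n::{finite,linorder} dtree \<Rightarrow> (real^'n::{finite,linorder}) set" where
  "Psi m T = (THE F. F \<in> faces (shi_arrangement m) \<and> (\<forall>p. p \<in> F \<longleftrightarrow> tree_point m T p))"

end

theory Submission
  imports Defs
begin

text \<open>
  Give a word \<open>v\<close> the key \<open>K v = (sum of v, v)\<close>, ordered lexicographically, where words are compared
  by putting prefixes first and, at the first difference, larger letters first. Integers act on keys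
  by shifting the sum, and the child of \<open>v\<close> of rank \<open>s\<close> comes immediately after \<open>K v + s\<close> among all
  words. Hence conditions (1)--(3) say that \<open>p\<^sub>j + s \<le> p\<^sub>i\<close> iff \<open>K v\<^sub>j + s < K v\<^sub>i\<close>, while
  (4) and (5) say that \<open>p\<^sub>i = p\<^sub>j + s\<close> iff a dashed path of total rank \<open>s\<close> leads from \<open>v\<^sub>j\<close> to \<open>v\<^sub>i\<close>.

  A tree has a point: let \<open>p\<^sub>i\<close> be the sum of \<open>v\<^sub>i\<close> plus a small multiple of the number of free nodes
  that are not after \<open>v\<^sub>i\<close> in the word order. A cadet directly follows its parent in that order, so
  the fractional parts agree exactly along dashed paths. In the affine span of the face the
  coordinates along each dashed path are tied together, which leaves one parameter per free node;
  for dashed edges of rank \<open>m\<close> the descent condition provides the hyperplane that does this.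

  Conversely, from a point \<open>p\<close> the words of the nodes are read off greedily in increasing order of the
  values: the value \<open>q\<close> is placed at the largest word \<open>v s\<close> such that \<open>v\<close> belongs to a smaller value
  \<open>q'\<close> with \<open>q' + s \<le> q\<close> (for \<open>s = m\<close> only if this inequality is visible to the arrangement).
  The descent condition makes every tree with point \<open>p\<close> obey the same recursion.
\<close>

section \<open>The order on words\<close>

definition lexrel :: "(vertex \<times> vertex) set" where
  "lexrel = lexord {(b, a). a < b}"

text \<open>\<open>klt v t w\<close> is \<open>K v + t < K w\<close>.\<close>

definition klt :: "vertex \<Rightarrow> int \<Rightarrow> vertex \<Rightarrow> bool" where
  "klt v t w \<longleftrightarrow> int (sum_list v) + t < int (sum_list w) \<or>
     int (sum_list v) + t = int (sum_list w) \<and> (v, w) \<in> lexrel"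

lemma lexrel_trans: "(u, v) \<in> lexrel \<Longrightarrow> (v, w) \<in> lexrel \<Longrightarrow> (u, w) \<in> lexrel"
  unfolding lexrel_def by (rule lexord_trans) (auto simp: trans_def)

lemma lexrel_irrefl [simp]: "(v, v) \<notin> lexrel"
  unfolding lexrel_def by (rule lexord_irreflexive) auto

lemma lexrel_asym: "(v, w) \<in> lexrel \<Longrightarrow> (w, v) \<notin> lexrel"
  using lexrel_trans lexrel_irrefl by blast

lemma lexrel_linear: "(v, w) \<in> lexrel \<or> v = w \<or> (w, v) \<in> lexrel"
  unfolding lexrel_def by (rule lexord_linear) auto

lemma lexrel_append_left_iff [simp]: "(u @ v, u @ w) \<in> lexrel \<longleftrightarrow> (v, w) \<in> lexrel"
  unfolding lexrel_def by (auto simp: lexord_same_pref_iff)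

lemma lexrel_Cons_iff [simp]: "(a # v, b # w) \<in> lexrel \<longleftrightarrow> b < a \<or> a = b \<and> (v, w) \<in> lexrel"
  unfolding lexrel_def by auto

lemma lexrel_Nil_iff [simp]: "([], w) \<in> lexrel \<longleftrightarrow> w \<noteq> []"
  unfolding lexrel_def by (cases w) auto

lemma lexrel_Nil_right [simp]: "(w, []) \<notin> lexrel"
  unfolding lexrel_def by auto

lemma lexrel_prefix [simp]: "(u, u @ w) \<in> lexrel \<longleftrightarrow> w \<noteq> []"
  using lexrel_append_left_iff[of u "[]" w] by simp

lemma lexrel_cases:
  assumes "(v, w) \<in> lexrel"
  obtains (prefix) x where "x \<noteq> []" "w = v @ x"
    | (diff) u a b v' w' where "v = u @ b # v'" "w = u @ a # w'" "a < b"
  using assms unfolding lexrel_def lexord_def by blast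

lemma vless_iff_klt: "vless v w \<longleftrightarrow> klt v 0 w"
proof -
  have "(v, w) \<in> lexrel \<longleftrightarrow>
      strict_prefix v w \<or> (\<exists>u a b v' w'. v = u @ b # v' \<and> w = u @ a # w' \<and> a < b)"
  proof
    assume "(v, w) \<in> lexrel"
    thus "strict_prefix v w \<or> (\<exists>u a b v' w'. v = u @ b # v' \<and> w = u @ a # w' \<and> a < b)"
      by (cases rule: lexrel_cases) (auto simp: strict_prefix_def)
  next
    assume "strict_prefix v w \<or> (\<exists>u a b v' w'. v = u @ b # v' \<and> w = u @ a # w' \<and> a < b)"
    thus "(v, w) \<in> lexrel" by (auto simp: strict_prefix_def prefix_def)
  qed
  thus ?thesis unfolding vless_def klt_def by auto
qed

lemma klt_trans: "klt u s v \<Longrightarrow> klt v t w \<Longrightarrow> klt u (s + t) w"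
  unfolding klt_def using lexrel_trans by auto

text \<open>Keys are totally ordered and shifts are invertible, so a failed comparison is one in the
  other direction or a tie. A tie forces the same word and shift 0.\<close>

lemma not_klt_iff: "\<not> klt v t w \<longleftrightarrow> klt w (- t) v \<or> v = w \<and> t = 0"
  unfolding klt_def using lexrel_linear[of v w] lexrel_asym[of v w] by auto

lemma klt_self [simp]: "klt v t v \<longleftrightarrow> t < 0"
  unfolding klt_def by auto

lemma klt_mono: "klt v t w \<Longrightarrow> s \<le> t \<Longrightarrow> klt v s w"
  unfolding klt_def by auto

text \<open>A word after \<open>v\<close> with the sum of \<open>v @ [s]\<close> either branches off
  inside \<open>v\<close>, where \<open>v @ [s]\<close> compares in the same way, or extends
  \<open>v\<close>. In the second case its next letter is at most \<open>s\<close>, and smaller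
  letters come later. Comparisons with children thus become comparisons of shifted keys.\<close>

lemma vleq_snoc_iff: "vleq (v @ [s]) w \<longleftrightarrow> klt v (int s) w"
proof -
  have "(v, w) \<in> lexrel \<longleftrightarrow> (v @ [s], w) \<in> lexrel \<or> v @ [s] = w"
    if sum: "sum_list v + s = sum_list w"
  proof
    assume "(v, w) \<in> lexrel"
    thus "(v @ [s], w) \<in> lexrel \<or> v @ [s] = w"
    proof (cases rule: lexrel_cases)
      case (prefix x)
      then obtain a y where x: "x = a # y" by (cases x) auto
      have "a \<le> s" using prefix sum x by simp
      thus ?thesis using prefix x by (cases y) auto
    qed auto
  next
    assume "(v @ [s], w) \<in> lexrel \<or> v @ [s] = w"
    moreover have "(v, v @ [s]) \<in> lexrel" by simp
    ultimately show "(v, w) \<in> lexrel" using lexrel_trans by blast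
  qed
  thus ?thesis unfolding vleq_def vless_iff_klt klt_def by auto
qed

lemma vleq_iff_not_vless: "vleq v w \<longleftrightarrow> \<not> vless w v"
  unfolding vleq_def vless_iff_klt using not_klt_iff[of w 0 v] by auto

lemma vleq_antisym: "vleq v w \<Longrightarrow> vleq w v \<Longrightarrow> v = w"
  unfolding vleq_def vless_iff_klt using klt_trans[of v 0 w 0 v] by auto

lemma vleq_trans: "vleq u v \<Longrightarrow> vleq v w \<Longrightarrow> vleq u w"
  unfolding vleq_def vless_iff_klt using klt_trans[of u 0 v 0 w] by auto

lemma vless_snoc_iff: "vless w (v @ [s]) \<longleftrightarrow> \<not> klt v (int s) w"
  using vleq_snoc_iff vleq_iff_not_vless by blast

lemma klt_snoc: "klt v (int s) (v @ [s])"
  by (simp add: klt_def)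

text \<open>If the shifted sums tie and \<open>v\<close> extends \<open>e\<close>, the next letter
  of \<open>v\<close> is at most \<open>r - s\<close>. By \<open>s \<ge> 1\<close> it is smaller
  than \<open>r\<close>, so \<open>e @ [r]\<close> still comes before \<open>v\<close>.\<close>

lemma klt_snoc_left:
  assumes "klt e (int r - int s) v" "s \<ge> 1"
  shows "klt (e @ [r]) (- int s) v"
proof (cases "int (sum_list e) + (int r - int s) < int (sum_list v)")
  case False
  hence *: "sum_list e + r = sum_list v + s" "(e, v) \<in> lexrel"
    using assms unfolding klt_def by auto
  from *(2) have "(e @ [r], v) \<in> lexrel"
  proof (cases rule: lexrel_cases)
    case (prefix x)
    then obtain a y where "x = a # y" by (cases x) auto
    thus ?thesis using prefix * assms by simp
  qed auto
  thus ?thesis using * by (auto simp: klt_def)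
qed (auto simp: klt_def)

lemma finite_vleq_max:
  assumes "finite X" "X \<noteq> {}"
  shows "\<exists>x\<in>X. \<forall>y\<in>X. vleq y x"
  using assms
proof (induction rule: finite_ne_induct)
  case (insert a X)
  then obtain x where x: "x \<in> X" "\<forall>y\<in>X. vleq y x" by blast
  show ?case
  proof (cases "vleq a x")
    case False
    hence "vleq x a" by (auto simp: vleq_iff_not_vless vless_iff_klt not_klt_iff)
    thus ?thesis using x vleq_trans by (auto simp: vleq_def)
  qed (use x in auto)
qed (auto simp: vleq_def)

section \<open>Vertices of a tree\<close>

lemma subtree_append:
  "subtree T (v @ x) = (case subtree T v of None \<Rightarrow> None | Some t \<Rightarrow> subtree t x)"
  by (induction T v rule: subtree.induct) auto

lemma subtree_snoc:
  "subtree T (v @ [r]) = (case subtree T v of Some (Node A d ts) \<Rightarrow>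
     if r < length ts then Some (ts ! r) else None | _ \<Rightarrow> None)"
  by (auto simp: subtree_append split: option.splits dtree.splits)

lemma is_node_snocD: "is_node T (v @ [r]) \<Longrightarrow> is_node T v"
  by (auto simp: is_node_def subtree_snoc split: option.splits dtree.splits if_splits)

lemma is_node_prefixD: "is_node T (v @ x) \<Longrightarrow> is_node T v"
proof (induction x rule: rev_induct)
  case (snoc a x)
  thus ?case using is_node_snocD[of T "v @ x" a] by simp
qed simp

lemma is_node_snoc_le:
  "ary_tree (m + 1) T \<Longrightarrow> is_node T (v @ [r]) \<Longrightarrow> r \<le> m"
  by (force simp: is_node_def ary_tree_def subtree_snoc split: option.splits dtree.splits if_splits)

lemma is_vertex_snoc:
  "ary_tree (m + 1) T \<Longrightarrow> is_node T v \<Longrightarrow> r \<le> m \<Longrightarrow> is_vertex T (v @ [r])"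
  by (force simp: is_node_def is_vertex_def ary_tree_def subtree_snoc)

lemma is_vertex_append_ConsD:
  assumes "is_vertex T (v @ a # y)"
  shows "is_node T v" "is_node T (v @ [a]) \<or> is_leaf T (v @ [a]) \<and> y = []"
proof -
  obtain t where t: "subtree T v = Some t" "subtree t (a # y) \<noteq> None"
    using assms by (auto simp: is_vertex_def subtree_append split: option.splits)
  then obtain A d ts where N: "t = Node A d ts" by (cases t) auto
  thus "is_node T v" using t by (auto simp: is_node_def)
  have "a < length ts" "subtree (ts ! a) y \<noteq> None" using t N by (auto split: if_splits)
  thus "is_node T (v @ [a]) \<or> is_leaf T (v @ [a]) \<and> y = []"
    using t N by (cases "ts ! a"; cases y) (auto simp: is_node_def is_leaf_def subtree_snoc)
qed

lemma is_node_not_leaf: "is_node T v \<Longrightarrow> \<not> is_leaf T v"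
  by (auto simp: is_node_def is_leaf_def)

lemma is_node_is_vertex: "is_node T v \<Longrightarrow> is_vertex T v"
  by (auto simp: is_node_def is_vertex_def)

lemma is_node_live: "is_node T v \<Longrightarrow> live T v"
  by (auto simp: live_def dead_leaf_def is_node_is_vertex dest: is_node_not_leaf)

lemma finite_vertices: "finite {v. is_vertex T v}"
proof (induction T)
  case Leaf
  have "is_vertex (Leaf :: 'a dtree) v \<longleftrightarrow> v = []" for v
    by (cases v) (auto simp: is_vertex_def)
  thus ?case by simp
next
  case (Node A d ts)
  have "{v. is_vertex (Node A d ts) v} \<subseteq>
      insert [] (\<Union>r<length ts. Cons r ` {v. is_vertex (ts ! r) v})"
  proof
    fix v assume "v \<in> {v. is_vertex (Node A d ts) v}"
    thus "v \<in> insert [] (\<Union>r<length ts. Cons r ` {v. is_vertex (ts ! r) v})"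
      by (cases v) (auto simp: is_vertex_def split: if_splits)
  qed
  moreover have "finite (insert [] (\<Union>r<length ts. Cons r ` {v. is_vertex (ts ! r) v}))"
    using Node by auto
  ultimately show ?case by (rule finite_subset)
qed

lemma finite_nodes: "finite {v. is_node T v}"
  using finite_vertices by (rule finite_subset[rotated]) (auto intro: is_node_is_vertex)

section \<open>Dashed paths\<close>

text \<open>As a relation on vertices, a dashed edge makes dashed paths its reflexive transitive
  closure, open to induction over edges.\<close>

definition dstep :: "'a dtree \<Rightarrow> vertex \<Rightarrow> vertex \<Rightarrow> bool" where
  "dstep T u w \<longleftrightarrow> (\<exists>r. w = u @ [r] \<and> dashed_edge T u r)"

lemma dashed_edgeD:
  assumes "dashed_edge T u r"
  shows "is_node T u" "is_node T (u @ [r])" "r > 0" "captive T (u @ [r])"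
    "\<And>r'. is_node T (u @ [r']) \<Longrightarrow> r' \<le> r"
proof -
  show "is_node T u" "is_node T (u @ [r])" "r > 0"
    using assms by (auto simp: dashed_edge_def is_cadet_def is_node_def)
  show "captive T (u @ [r])" using assms \<open>is_node T (u @ [r])\<close> by (auto simp: captive_def)
  show "r' \<le> r" if "is_node T (u @ [r'])" for r'
    using assms that unfolding dashed_edge_def is_cadet_def by (meson linorder_not_less)
qed

lemma captive_iff_dstep: "captive T w \<longleftrightarrow> (\<exists>u. dstep T u w)"
  by (auto simp: captive_def dstep_def dest: dashed_edgeD)

lemma dashed_path_iff: "dashed_path T u w \<longleftrightarrow> is_node T u \<and> (dstep T)\<^sup>*\<^sup>* u w"
proof
  assume "dashed_path T u w"
  then obtain x where x: "is_node T u" "w = u @ x"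
      "\<forall>k<length x. dashed_edge T (u @ take k x) (x ! k)"
    by (auto simp: dashed_path_def)
  have "(dstep T)\<^sup>*\<^sup>* u (u @ x)" using x(3)
  proof (induction x rule: rev_induct)
    case (snoc a x)
    have "\<forall>k<length x. dashed_edge T (u @ take k x) (x ! k)"
    proof (intro allI impI)
      fix k assume "k < length x"
      thus "dashed_edge T (u @ take k x) (x ! k)"
        using snoc.prems[rule_format, of k] by (simp add: nth_append)
    qed
    hence "(dstep T)\<^sup>*\<^sup>* u (u @ x)" by (rule snoc.IH)
    moreover have "dashed_edge T (u @ x) a" using snoc.prems[rule_format, of "length x"] by simp
    hence "dstep T (u @ x) (u @ x @ [a])" by (auto simp: dstep_def)
    ultimately show ?case by auto
  qed simp
  thus "is_node T u \<and> (dstep T)\<^sup>*\<^sup>* u w" using x by auto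
next
  assume *: "is_node T u \<and> (dstep T)\<^sup>*\<^sup>* u w"
  hence "(dstep T)\<^sup>*\<^sup>* u w" by blast
  thus "dashed_path T u w"
  proof (induction rule: rtranclp_induct)
    case base
    thus ?case using * by (auto simp: dashed_path_def)
  next
    case (step y z)
    obtain x where x: "y = u @ x" "\<forall>k<length x. dashed_edge T (u @ take k x) (x ! k)"
      using step.IH by (auto simp: dashed_path_def)
    obtain r where r: "z = y @ [r]" "dashed_edge T y r" using step.hyps by (auto simp: dstep_def)
    have "\<forall>k<length (x @ [r]). dashed_edge T (u @ take k (x @ [r])) ((x @ [r]) ! k)"
      using x r by (auto simp: nth_append less_Suc_eq)
    moreover have "is_node T z" using r dashed_edgeD by blast
    moreover have "z = u @ (x @ [r])" using x r by simp
    ultimately show ?case using * unfolding dashed_path_def by blast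
  qed
qed

section \<open>The next live vertex along a dashed path\<close>

lemma dstep_sum_less: "dstep T u w \<Longrightarrow> sum_list u < sum_list w"
  by (auto simp: dstep_def dest: dashed_edgeD)

lemma dpath_sum_le: "(dstep T)\<^sup>*\<^sup>* u w \<Longrightarrow> u = w \<or> sum_list u < sum_list w"
  by (induction rule: rtranclp_induct) (auto dest: dstep_sum_less)

lemma dpath_lexrel: "(dstep T)\<^sup>*\<^sup>* u w \<Longrightarrow> u = w \<or> (u, w) \<in> lexrel"
proof (induction rule: rtranclp_induct)
  case (step y z)
  hence "(y, z) \<in> lexrel" by (auto simp: dstep_def)
  thus ?case using step lexrel_trans by blast
qed simp

text \<open>Beyond the cadet all siblings are leaves, and a captive cadet makes them dead.\<close>

lemma dead_leaf_snocI:
  "dashed_edge T v c \<Longrightarrow> c < y \<Longrightarrow> is_vertex T (v @ [y]) \<Longrightarrow> dead_leaf T (v @ [y])"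
  using is_vertex_append_ConsD[of T v y "[]"] dashed_edgeD[of T v c]
  unfolding dead_leaf_def by force

text \<open>No live vertex separates \<open>K v + s\<close> from \<open>K (v @ [c]) + t\<close>. On
  a tie of sums, let \<open>x\<close> extend \<open>v\<close> with next letter \<open>a\<close>: if
  \<open>a < c\<close> it comes after \<open>v @ [c]\<close>, if \<open>a = c\<close> it properly
  extends that word since \<open>t \<ge> 1\<close>, and if \<open>a > c\<close> it is a dead
  leaf.\<close>

lemma klt_dashed_edge:
  assumes edge: "dashed_edge T v c" and x: "live T x" and "klt v (int s) x"
    and "c + t = s" and t: "t \<ge> 1"
  shows "klt (v @ [c]) (int t) x"
proof (cases "sum_list v + s < sum_list x")
  case False
  hence sum: "sum_list v + s = sum_list x" and "(v, x) \<in> lexrel"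
    using assms unfolding klt_def by auto
  from this(2) have "(v @ [c], x) \<in> lexrel"
  proof (cases rule: lexrel_cases)
    case (prefix z)
    then obtain a y where z: "z = a # y" by (cases z) auto
    have *: "is_vertex T (v @ a # y)" using x prefix z by (auto simp: live_def)
    show ?thesis
    proof (cases a c rule: linorder_cases)
      case greater
      hence "\<not> is_node T (v @ [a])" using dashed_edgeD(5)[OF edge] by force
      hence "y = []" using is_vertex_append_ConsD(2)[OF *] by blast
      hence "dead_leaf T x" using dead_leaf_snocI[OF edge greater] * prefix z by simp
      thus ?thesis using x by (simp add: live_def)
    next
      case equal
      thus ?thesis using prefix z sum assms(4) t by (cases y) auto
    qed (use prefix z in auto)
  qed auto
  thus ?thesis using sum assms(4) by (auto simp: klt_def)
qed (use assms(4) in \<open>auto simp: klt_def\<close>)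

text \<open>Walking down the path trades remaining rank for sum without passing a live vertex. So
  all live vertices after \<open>K v + s\<close> come after \<open>K u + t\<close>, whose immediate
  successor \<open>u @ [t]\<close> is live.\<close>

lemma nextlive_eqI:
  assumes path: "(dstep T)\<^sup>*\<^sup>* v u" and live: "live T (u @ [t])"
    and sum: "sum_list u + t = sum_list v + s" and t: "t \<ge> 1"
  shows "nextlive T (v @ [s]) = u @ [t]"
proof -
  have klt: "klt u (int t) x" if x: "live T x" "klt v (int s) x" for x
  proof -
    \<comment> \<open>Here \<open>t\<close> has to vary: the rank left over at \<open>y\<close> is
      larger by \<open>c\<close> than the one at \<open>z\<close>.\<close>
    have "sum_list u + t = sum_list v + s \<longrightarrow> t \<ge> 1 \<longrightarrow> klt u (int t) x" for t using path
    proof (induction arbitrary: t rule: rtranclp_induct)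
      case base
      thus ?case using x by auto
    next
      case (step y z)
      obtain c where c: "z = y @ [c]" "dashed_edge T y c" using step.hyps by (auto simp: dstep_def)
      show ?case
      proof (intro impI)
        assume *: "sum_list z + t = sum_list v + s" "1 \<le> t"
        hence "klt y (int (c + t)) x" using step.IH[of "c + t"] c by simp
        from klt_dashed_edge[OF c(2) x(1) this refl *(2)] show "klt z (int t) x" using c by simp
      qed
    qed
    thus ?thesis using sum t by blast
  qed
  have "klt v (int s) (u @ [t])"
  proof -
    have "(u, u @ [t]) \<in> lexrel" by simp
    hence "(v, u @ [t]) \<in> lexrel" using dpath_lexrel[OF path] lexrel_trans by blast
    thus ?thesis using sum by (auto simp: klt_def)
  qed
  thus ?thesis unfolding nextlive_def
    using live klt by (intro the_equality) (auto simp: vleq_snoc_iff intro: vleq_antisym)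
qed

text \<open>A dead leaf of rank \<open>s\<close> has a captive sibling of rank \<open>c < s\<close>.
  Moving there leaves the rank \<open>s - c\<close>, which is smaller because cadets have positive
  rank, so the search ends.\<close>

lemma live_on_dashed_path:
  assumes ary: "ary_tree (m + 1) T"
  shows "is_node T v \<Longrightarrow> 1 \<le> s \<Longrightarrow> s \<le> m \<Longrightarrow>
     \<exists>u t. (dstep T)\<^sup>*\<^sup>* v u \<and> live T (u @ [t]) \<and> sum_list u + t = sum_list v + s \<and> t \<ge> 1"
proof (induction s arbitrary: v rule: less_induct)
  case (less s)
  have vertex: "is_vertex T (v @ [s])" using is_vertex_snoc[OF ary] less.prems by blast
  show ?case
  proof (cases "live T (v @ [s])")
    case False
    then obtain c where c: "c < s" "captive T (v @ [c])"
      using vertex by (auto simp: live_def dead_leaf_def)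
    hence edge: "dashed_edge T v c" by (auto simp: captive_def)
    have "\<exists>u t. (dstep T)\<^sup>*\<^sup>* (v @ [c]) u \<and> live T (u @ [t]) \<and>
        sum_list u + t = sum_list (v @ [c]) + (s - c) \<and> t \<ge> 1"
      using less.prems c dashed_edgeD[OF edge] by (intro less.IH) auto
    then obtain u t where "(dstep T)\<^sup>*\<^sup>* (v @ [c]) u" "live T (u @ [t])"
        "sum_list u + t = sum_list v + s" "t \<ge> 1"
      using c by auto
    moreover have "dstep T v (v @ [c])" using edge by (auto simp: dstep_def)
    ultimately show ?thesis by (meson converse_rtranclp_into_rtranclp)
  qed (use less.prems in auto)
qed

text \<open>The live vertex found by following dashed edges has sum \<open>sum_list v + s\<close>.
  Conversely, the last edge of a path of this total rank displays \<open>w\<close> as a live vertex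
  \<open>u @ [t]\<close>, to which \<open>nextlive_eqI\<close> applies.\<close>

lemma nextlive_dashed_path_iff:
  assumes ary: "ary_tree (m + 1) T" and v: "is_node T v" and s: "1 \<le> s" "s \<le> m"
  shows "w = nextlive T (v @ [s]) \<and> dashed_path T v w \<longleftrightarrow>
    (dstep T)\<^sup>*\<^sup>* v w \<and> sum_list w = sum_list v + s"
proof -
  have "sum_list w = sum_list v + s" if w: "w = nextlive T (v @ [s])"
  proof -
    obtain u t where "(dstep T)\<^sup>*\<^sup>* v u" "live T (u @ [t])"
        "sum_list u + t = sum_list v + s" "t \<ge> 1"
      using live_on_dashed_path[OF ary v s] by blast
    thus ?thesis using nextlive_eqI w by fastforce
  qed
  moreover have "w = nextlive T (v @ [s])"
    if w: "(dstep T)\<^sup>*\<^sup>* v w" "sum_list w = sum_list v + s"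
  proof -
    have "w \<noteq> v" using w s by auto
    then obtain u where u: "(dstep T)\<^sup>*\<^sup>* v u" "dstep T u w" using w(1) by (metis rtranclp.cases)
    then obtain t where t: "w = u @ [t]" "dashed_edge T u t" by (auto simp: dstep_def)
    have "live T (u @ [t])" "t \<ge> 1" using dashed_edgeD[OF t(2)] by (auto intro: is_node_live)
    thus ?thesis using nextlive_eqI[OF u(1), of t s] t w by simp
  qed
  ultimately show ?thesis using v by (auto simp: dashed_path_iff)
qed

section \<open>Points of a tree\<close>

lemma decorated_aryD: "decorated m T \<Longrightarrow> ary_tree (m + 1) T"
  by (simp add: decorated_def)

lemma node_of_eqI:
  assumes "decorated m T" "is_node T v" "i \<in> label T v"
  shows "node_of T i = v"
  unfolding node_of_def using assms by (intro the_equality) (auto simp: decorated_def)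

lemma node_of_props:
  assumes "decorated m T"
  shows "is_node T (node_of T i)" "i \<in> label T (node_of T i)"
proof -
  have "i \<in> (\<Union>v\<in>{v. is_node T v}. label T v)" using assms by (simp add: decorated_def)
  then obtain v where "is_node T v" "i \<in> label T v" by blast
  thus "is_node T (node_of T i)" "i \<in> label T (node_of T i)"
    using node_of_eqI[OF assms] by auto
qed

lemma node_of_surj:
  assumes "decorated m T" "is_node T v"
  shows "\<exists>i. node_of T i = v"
proof -
  have "label T v \<noteq> {}" using assms by (simp add: decorated_def)
  thus ?thesis using node_of_eqI[OF assms] by blast
qed

text \<open>Conditions (2) and (3) appear negated, because preceding a child is the failure of a
  shifted key comparison. They merge into one family of shifts, in which the order of the indices
  matters only for \<open>s = m\<close>; so do (4) and (5).\<close>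

lemma tree_point_iff:
  fixes T :: "'n::{finite,linorder} dtree" and p :: "real^'n::{finite,linorder}"
  assumes dec: "decorated m T" and m: "m \<ge> 1"
  defines "w \<equiv> node_of T"
  shows "tree_point m T p \<longleftrightarrow>
    (\<forall>i j. p $ i < p $ j \<longleftrightarrow> klt (w i) 0 (w j)) \<and>
    (\<forall>i j s. 1 \<le> s \<and> s \<le> m \<and> (s < m \<or> i < j) \<longrightarrow>
      (p $ j + real s \<le> p $ i \<longleftrightarrow> klt (w j) (int s) (w i)) \<and>
      (p $ i = p $ j + real s \<longleftrightarrow> (dstep T)\<^sup>*\<^sup>* (w j) (w i) \<and> sum_list (w i) = sum_list (w j) + s))"
proof -
  define le where "le \<longleftrightarrow> (\<forall>i j. p $ i < p $ j \<longleftrightarrow> klt (w i) 0 (w j))"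
  define A where "A s i j \<longleftrightarrow> (p $ j + real s \<le> p $ i \<longleftrightarrow> klt (w j) (int s) (w i))" for s i j
  define B where "B s i j \<longleftrightarrow> (p $ i = p $ j + real s \<longleftrightarrow>
      (dstep T)\<^sup>*\<^sup>* (w j) (w i) \<and> sum_list (w i) = sum_list (w j) + s)" for s i j
  have le: "(\<forall>i j. p $ i \<le> p $ j \<longleftrightarrow> vleq (node_of T i) (node_of T j)) \<longleftrightarrow> le"
    unfolding le_def vleq_iff_not_vless vless_iff_klt w_def linorder_not_less[symmetric] by blast
  have A: "(p $ i < p $ j + real s \<longleftrightarrow> vless (node_of T i) (child_of T s j)) \<longleftrightarrow> A s i j" for i j s
    unfolding A_def child_of_def w_def vless_snoc_iff by linarith
  have B: "(p $ i = p $ j + real s \<longleftrightarrow>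
      node_of T i = nextlive T (child_of T s j) \<and> dashed_path T (node_of T j) (node_of T i)) \<longleftrightarrow> B s i j"
    if "1 \<le> s" "s \<le> m" for i j s
    unfolding B_def child_of_def w_def
    using nextlive_dashed_path_iff[OF decorated_aryD[OF dec] node_of_props(1)[OF dec] that] by simp
  have "tree_point m T p \<longleftrightarrow> le \<and> (\<forall>i j. \<forall>s\<in>{1..m - 1}. A s i j) \<and> (\<forall>i j. i < j \<longrightarrow> A m i j) \<and>
      (\<forall>i j. \<forall>s\<in>{1..m - 1}. B s i j) \<and> (\<forall>i j. i < j \<longrightarrow> B m i j)"
  proof -
    have B': "(\<forall>s\<in>{1..m - 1}. p $ i = p $ j + real s \<longleftrightarrow>
        node_of T i = nextlive T (child_of T s j) \<and> dashed_path T (node_of T j) (node_of T i)) \<longleftrightarrow>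
        (\<forall>s\<in>{1..m - 1}. B s i j)" for i j
      by (intro ball_cong refl B) auto
    show ?thesis unfolding tree_point_def le A B' B[OF m order_refl] ..
  qed
  also have "\<dots> \<longleftrightarrow> le \<and> (\<forall>i j s. 1 \<le> s \<and> s \<le> m \<and> (s < m \<or> i < j) \<longrightarrow> A s i j \<and> B s i j)"
  proof -
    have *: "1 \<le> s \<and> s \<le> m \<and> (s < m \<or> i < j) \<longleftrightarrow> s \<in> {1..m - 1} \<or> s = m \<and> i < j" for s and i j :: 'n
      using m by auto
    show ?thesis unfolding * by blast
  qed
  finally show ?thesis unfolding le_def A_def B_def .
qed

section \<open>Free nodes and the fractional parts of a point\<close>

lemma dstep_lexrel_successor:
  assumes "dstep T v v'" "is_node T u" "(v, u) \<in> lexrel"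
  shows "u = v' \<or> (v', u) \<in> lexrel"
proof -
  obtain c where c: "v' = v @ [c]" "dashed_edge T v c" using assms by (auto simp: dstep_def)
  from assms(3) show ?thesis
  proof (cases rule: lexrel_cases)
    case (prefix x)
    then obtain a y where x: "x = a # y" by (cases x) auto
    hence "is_node T (v @ [a])" using is_node_prefixD[of T "v @ [a]" y] assms prefix by simp
    \<comment> \<open>The cadet has the largest rank among the node children and larger letters come
      first, so no node fits between \<open>v\<close> and \<open>v'\<close>.\<close>
    hence "a \<le> c" using dashed_edgeD(5)[OF c(2)] by blast
    thus ?thesis using prefix x c by (cases y) auto
  qed (use c in auto)
qed

text \<open>
  The position in the traversal that visits a node before its descendants and children of larger
  rank first. A cadet is visited right after its parent, so a dashed path does not advance it.
\<close>

definition free_rank :: "'a dtree \<Rightarrow> vertex \<Rightarrow> nat" where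
  "free_rank T v = card {u. free_node T u \<and> (u = v \<or> (u, v) \<in> lexrel)}"

lemma finite_free: "finite {u. free_node T u}" "finite {u. free_node T u \<and> P u}"
  using finite_nodes by (rule finite_subset[rotated], auto simp: free_node_def)+

lemma free_rank_mono: "(v, w) \<in> lexrel \<Longrightarrow> free_rank T v \<le> free_rank T w"
  unfolding free_rank_def by (intro card_mono finite_free) (auto intro: lexrel_trans)

lemma free_rank_le: "free_rank T v \<le> card {u. free_node T u}"
  unfolding free_rank_def by (intro card_mono finite_free) auto

text \<open>No node is visited between \<open>v\<close> and \<open>w\<close>, and \<open>w\<close>
  itself is captive and hence not counted.\<close>

lemma free_rank_dstep:
  assumes "dstep T v w"
  shows "free_rank T v = free_rank T w"
proof -
  have vw: "(v, w) \<in> lexrel" using assms by (auto simp: dstep_def)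
  have "u = v \<or> (u, v) \<in> lexrel" if "free_node T u" "u = w \<or> (u, w) \<in> lexrel" for u
  proof (rule ccontr)
    assume "\<not> ?thesis"
    hence "(v, u) \<in> lexrel" using lexrel_linear by blast
    hence "u = w \<or> (w, u) \<in> lexrel"
      using dstep_lexrel_successor[OF assms] that by (auto simp: free_node_def)
    hence "u = w" using that lexrel_asym by blast
    thus False using that assms by (auto simp: free_node_def captive_iff_dstep)
  qed
  hence "{u. free_node T u \<and> (u = v \<or> (u, v) \<in> lexrel)} =
      {u. free_node T u \<and> (u = w \<or> (u, w) \<in> lexrel)}"
    using vw by (auto intro: lexrel_trans)
  thus ?thesis by (simp add: free_rank_def)
qed

lemma free_rank_dpath: "(dstep T)\<^sup>*\<^sup>* v w \<Longrightarrow> free_rank T v = free_rank T w"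
  by (induction rule: rtranclp_induct) (auto dest: free_rank_dstep)

lemma free_rank_strict_free:
  assumes "(v, w) \<in> lexrel" "free_node T w"
  shows "free_rank T v < free_rank T w"
  unfolding free_rank_def
proof (rule psubset_card_mono[OF finite_free(2)])
  have "w \<notin> {u. free_node T u \<and> (u = v \<or> (u, v) \<in> lexrel)}"
    using assms lexrel_asym by auto
  moreover have "w \<in> {u. free_node T u \<and> (u = w \<or> (u, w) \<in> lexrel)}" using assms by auto
  ultimately show "{u. free_node T u \<and> (u = v \<or> (u, v) \<in> lexrel)} \<subset>
      {u. free_node T u \<and> (u = w \<or> (u, w) \<in> lexrel)}"
    using assms by (auto intro: lexrel_trans)
qed

text \<open>A free \<open>w\<close> is itself counted for \<open>w\<close> but not for
  \<open>v\<close>. A captive \<open>w\<close> has the rank of its parent \<open>e\<close>, its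
  direct predecessor among the nodes; then \<open>v\<close> precedes \<open>e\<close> too, and the
  induction passes to \<open>e\<close>.\<close>

lemma free_rank_strict:
  "is_node T v \<Longrightarrow> is_node T w \<Longrightarrow> (v, w) \<in> lexrel \<Longrightarrow> \<not> (dstep T)\<^sup>*\<^sup>* v w \<Longrightarrow>
    free_rank T v < free_rank T w"
proof (induction "length w" arbitrary: w rule: less_induct)
  case less
  show ?case
  proof (cases "captive T w")
    case False
    thus ?thesis using less.prems free_rank_strict_free by (auto simp: free_node_def)
  next
    case True
    then obtain e where e: "dstep T e w" by (auto simp: captive_iff_dstep)
    hence e': "is_node T e" "length e < length w" by (auto simp: dstep_def dest: dashed_edgeD)
    have "v \<noteq> e" using e less.prems by auto
    moreover have "(e, v) \<notin> lexrel"
      using dstep_lexrel_successor[OF e] less.prems lexrel_asym by auto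
    ultimately have "(v, e) \<in> lexrel" using lexrel_linear by blast
    moreover have "\<not> (dstep T)\<^sup>*\<^sup>* v e" using less.prems e by (auto intro: rtranclp.rtrancl_into_rtrancl)
    ultimately have "free_rank T v < free_rank T e" using less.hyps e' less.prems(1) by blast
    thus ?thesis using free_rank_dstep[OF e] by simp
  qed
qed

lemma free_rank_eq_iff:
  assumes "is_node T v" "is_node T w"
  shows "free_rank T v = free_rank T w \<longleftrightarrow> (dstep T)\<^sup>*\<^sup>* v w \<or> (dstep T)\<^sup>*\<^sup>* w v"
  using lexrel_linear[of v w] free_rank_strict[OF assms] free_rank_strict[OF assms(2,1)]
    free_rank_dpath[of T v w] free_rank_dpath[of T w v]
  by (metis nat_neq_iff rtranclp.rtrancl_refl)

text \<open>Climbing dashed edges leads from any node to a free node of the same rank, and distinct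
  free nodes have distinct ranks.\<close>

lemma card_free_rank_image:
  "card (free_rank T ` {v. is_node T v}) = card {u. free_node T u}"
proof -
  have "\<exists>u. free_node T u \<and> free_rank T v = free_rank T u" if "is_node T v" for v
    using that
  proof (induction "length v" arbitrary: v rule: less_induct)
    case less
    show ?case
    proof (cases "captive T v")
      case False
      thus ?thesis using less.prems by (auto simp: free_node_def)
    next
      case True
      then obtain e where e: "dstep T e v" by (auto simp: captive_iff_dstep)
      hence "is_node T e" "length e < length v" by (auto simp: dstep_def dest: dashed_edgeD)
      thus ?thesis using less.hyps free_rank_dstep[OF e] by metis
    qed
  qed
  hence "free_rank T ` {v. is_node T v} = free_rank T ` {u. free_node T u}"
    by (force simp: free_node_def)
  moreover have "inj_on (free_rank T) {u. free_node T u}"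
  proof (rule inj_onI)
    fix u v assume "u \<in> {u. free_node T u}" "v \<in> {u. free_node T u}" "free_rank T u = free_rank T v"
    thus "u = v" using lexrel_linear[of u v] free_rank_strict_free by fastforce
  qed
  ultimately show ?thesis by (simp add: card_image)
qed

lemma tree_point_exists:
  fixes T :: "'n::{finite,linorder} dtree"
  assumes dec: "decorated m T" and m: "m \<ge> 1"
  shows "\<exists>p. tree_point m T p"
proof -
  \<comment> \<open>Dividing by more than the number of free nodes keeps \<open>g\<close> at least 0
    and below 1, so a difference of word sums outweighs it.\<close>
  define g where "g v = real (free_rank T v) / (real (card {u. free_node T u}) + 1)" for v
  define P where "P v = real (sum_list v) + g v" for v
  have g_less: "g v < g w \<longleftrightarrow> free_rank T v < free_rank T w" for v w
    unfolding g_def by (simp add: divide_less_cancel)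
  have g: "0 \<le> g v" "g v < 1" for v
    using free_rank_le[of T v] by (auto simp: g_def divide_simps)
  have less: "P v < P w" if "is_node T v" "is_node T w" "klt v 0 w" for v w
  proof (cases "sum_list v = sum_list w")
    case True
    hence *: "(v, w) \<in> lexrel" using that by (auto simp: klt_def)
    \<comment> \<open>Dashed edges have positive rank, so no dashed path joins two distinct words of
      equal sum.\<close>
    hence "\<not> (dstep T)\<^sup>*\<^sup>* v w" using True dpath_sum_le by fastforce
    hence "g v < g w" using g_less free_rank_strict that * by blast
    thus ?thesis using True by (simp add: P_def)
  next
    case False
    hence "sum_list v + 1 \<le> sum_list w" using that by (auto simp: klt_def)
    hence "real (sum_list v) + 1 \<le> real (sum_list w)" by linarith
    thus ?thesis using g[of v] g[of w] by (simp add: P_def)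
  qed
  have le: "P v + real s \<le> P w" if "klt v (int s) w" for v w s
  proof (cases "sum_list v + s = sum_list w")
    case True
    hence "free_rank T v \<le> free_rank T w" using that free_rank_mono by (auto simp: klt_def)
    hence "g v \<le> g w" using g_less[of w v] by linarith
    thus ?thesis using True unfolding P_def by linarith
  next
    case False
    hence "sum_list v + s + 1 \<le> sum_list w" using that by (auto simp: klt_def)
    hence "real (sum_list v) + real s + 1 \<le> real (sum_list w)" by linarith
    thus ?thesis using g[of v] g[of w] by (simp add: P_def)
  qed
  have gt: "P w < P v + real s"
    if "is_node T v" "is_node T w" "\<not> klt v (int s) w" "s \<ge> 1" for v w s
  proof (cases "sum_list v + s = sum_list w")
    case True
    hence *: "(w, v) \<in> lexrel" using that lexrel_linear[of v w] by (auto simp: klt_def)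
    have "\<not> (dstep T)\<^sup>*\<^sup>* w v" using True that dpath_sum_le by fastforce
    hence "g w < g v" using g_less free_rank_strict that * by blast
    thus ?thesis using True unfolding P_def by linarith
  next
    case False
    hence "sum_list w + 1 \<le> sum_list v + s" using that by (auto simp: klt_def)
    hence "real (sum_list w) + 1 \<le> real (sum_list v) + real s" by linarith
    thus ?thesis using g[of v] g[of w] by (simp add: P_def)
  qed
  have eq: "P w = P v + real s \<longleftrightarrow> (dstep T)\<^sup>*\<^sup>* v w \<and> sum_list w = sum_list v + s"
    if "is_node T v" "is_node T w" "s \<ge> 1" for v w s
  proof
    assume *: "P w = P v + real s"
    have "real (sum_list w) - real (sum_list v + s) = g v - g w"
      using * unfolding P_def by simp
    \<comment> \<open>Two fractional parts differ by less than 1, which forces the integer parts to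
      agree.\<close>
    hence "\<bar>real (sum_list w) - real (sum_list v + s)\<bar> < 1" using g[of v] g[of w] by linarith
    hence sum: "sum_list w = sum_list v + s" by linarith
    hence "g v = g w" using * unfolding P_def by simp
    hence "free_rank T v = free_rank T w" using g_less by (metis less_irrefl linorder_neqE_nat)
    hence "(dstep T)\<^sup>*\<^sup>* v w \<or> (dstep T)\<^sup>*\<^sup>* w v" using free_rank_eq_iff that by blast
    thus "(dstep T)\<^sup>*\<^sup>* v w \<and> sum_list w = sum_list v + s"
      using sum that dpath_sum_le by fastforce
  next
    assume "(dstep T)\<^sup>*\<^sup>* v w \<and> sum_list w = sum_list v + s"
    thus "P w = P v + real s" using free_rank_dpath[of T v w] by (simp add: P_def g_def)
  qed
  note node = node_of_props(1)[OF dec]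
  have "tree_point m T (\<chi> i. P (node_of T i))"
    unfolding tree_point_iff[OF dec m]
  proof (intro conjI allI impI)
    fix i j :: 'n
    show "(\<chi> i. P (node_of T i)) $ i < (\<chi> i. P (node_of T i)) $ j \<longleftrightarrow>
        klt (node_of T i) 0 (node_of T j)"
      using less[OF node node, of i j] less[OF node node, of j i]
        not_klt_iff[of "node_of T i" 0 "node_of T j"] by auto
  next
    fix i j :: 'n and s assume s: "1 \<le> s \<and> s \<le> m \<and> (s < m \<or> i < j)"
    show "(\<chi> i. P (node_of T i)) $ j + real s \<le> (\<chi> i. P (node_of T i)) $ i \<longleftrightarrow>
        klt (node_of T j) (int s) (node_of T i)"
      using le[of "node_of T j" s "node_of T i"] gt[OF node node, of j s i] s by force
    show "(\<chi> i. P (node_of T i)) $ i = (\<chi> i. P (node_of T i)) $ j + real s \<longleftrightarrow>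
        (dstep T)\<^sup>*\<^sup>* (node_of T j) (node_of T i) \<and>
        sum_list (node_of T i) = sum_list (node_of T j) + s"
      using eq[OF node node, of s i j] s by simp
  qed
  thus ?thesis by blast
qed

section \<open>Faces of the Shi arrangement\<close>

text \<open>Equality of signs, written with shifts \<open>s \<ge> 0\<close> only: a hyperplane with
  negative shift is read with \<open>i\<close> and \<open>j\<close> exchanged. Shift 0 compares the
  coordinates themselves.\<close>

definition shi_equiv :: "nat \<Rightarrow> real^'n::{finite,linorder} \<Rightarrow> real^'n::{finite,linorder} \<Rightarrow> bool" where
  "shi_equiv m p q \<longleftrightarrow> (\<forall>i j s. s \<le> m \<and> (s < m \<or> i < j) \<longrightarrow>
     (p $ j + real s \<le> p $ i \<longleftrightarrow> q $ j + real s \<le> q $ i) \<and>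
     (p $ i = p $ j + real s \<longleftrightarrow> q $ i = q $ j + real s))"

lemma shi_equiv_iff_hyperplanes:
  fixes p q :: "real^'n::{finite,linorder}"
  assumes "m \<ge> 1"
  shows "shi_equiv m p q \<longleftrightarrow> (\<forall>i j s. i < j \<and> s \<in> {- int m + 1..int m} \<longrightarrow>
     (p $ i - p $ j < real_of_int s \<longleftrightarrow> q $ i - q $ j < real_of_int s) \<and>
     (p $ i - p $ j = real_of_int s \<longleftrightarrow> q $ i - q $ j = real_of_int s))" (is "_ \<longleftrightarrow> ?R")
proof -
  have pos: "x - y < c \<longleftrightarrow> \<not> y + c \<le> x" "x - y = c \<longleftrightarrow> x = y + c" for x y c :: real by auto
  have neg: "x - y < - c \<longleftrightarrow> x + c \<le> y \<and> y \<noteq> x + c" "x - y = - c \<longleftrightarrow> y = x + c" for x y c :: real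
    by auto
  show ?thesis
  proof
    assume eq: "shi_equiv m p q"
    show ?R
    proof (intro allI impI)
      fix i j :: 'n and s :: int assume *: "i < j \<and> s \<in> {- int m + 1..int m}"
      show "(p $ i - p $ j < real_of_int s \<longleftrightarrow> q $ i - q $ j < real_of_int s) \<and>
          (p $ i - p $ j = real_of_int s \<longleftrightarrow> q $ i - q $ j = real_of_int s)"
      proof (cases "s \<ge> 0")
        case True
        then obtain t where t: "s = int t" by (metis nonneg_int_cases)
        hence "t \<le> m" using * by auto
        hence "(p $ j + real t \<le> p $ i \<longleftrightarrow> q $ j + real t \<le> q $ i) \<and>
            (p $ i = p $ j + real t \<longleftrightarrow> q $ i = q $ j + real t)"
          using eq * unfolding shi_equiv_def by blast
        thus ?thesis using pos t by simp
      next
        case False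
        then obtain t where t: "s = - int t" by (metis linear nonpos_int_cases)
        \<comment> \<open>The least shift is \<open>- int m + 1\<close>; this is why exchanged pairs
          see every shift except \<open>m\<close>.\<close>
        hence "t < m" using * by auto
        hence "(p $ i + real t \<le> p $ j \<longleftrightarrow> q $ i + real t \<le> q $ j) \<and>
            (p $ j = p $ i + real t \<longleftrightarrow> q $ j = q $ i + real t)"
          using eq unfolding shi_equiv_def by (meson less_imp_le)
        thus ?thesis using neg t by simp
      qed
    qed
  next
    assume R: ?R
    show "shi_equiv m p q"
      unfolding shi_equiv_def
    proof (intro allI impI)
      fix i j :: 'n and s assume *: "s \<le> m \<and> (s < m \<or> i < j)"
      show "(p $ j + real s \<le> p $ i \<longleftrightarrow> q $ j + real s \<le> q $ i) \<and>
          (p $ i = p $ j + real s \<longleftrightarrow> q $ i = q $ j + real s)"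
      proof (cases i j rule: linorder_cases)
        case less
        hence "(p $ i - p $ j < real s \<longleftrightarrow> q $ i - q $ j < real s) \<and>
            (p $ i - p $ j = real s \<longleftrightarrow> q $ i - q $ j = real s)"
          using R[rule_format, of i j "int s"] * assms by simp
        thus ?thesis unfolding pos by simp
      next
        case greater
        hence "s < m" using * by auto
        hence "(p $ j - p $ i < - real s \<longleftrightarrow> q $ j - q $ i < - real s) \<and>
            (p $ j - p $ i = - real s \<longleftrightarrow> q $ j - q $ i = - real s)"
          using R[rule_format, of j i "- int s"] greater by simp
        thus ?thesis unfolding neg by auto
      qed auto
    qed
  qed
qed

text \<open>A face is cut out by the signs of any one of its points, so a base point can replace the
  choice of sides.\<close>

lemma faces_iff:
  fixes F :: "'v::euclidean_space set"
  shows "F \<in> faces H \<longleftrightarrow> (\<exists>p. F = {x. \<forall>(a, c)\<in>H.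
     (a \<bullet> p < c \<longleftrightarrow> a \<bullet> x < c) \<and> (a \<bullet> p = c \<longleftrightarrow> a \<bullet> x = c)})"
proof -
  define side where "side = (\<lambda>(a, c) (x :: 'v). if a \<bullet> x < c then Below else if a \<bullet> x = c then On else Above)"
  have on_side: "on_side \<sigma> h x \<longleftrightarrow> side h x = \<sigma>" for \<sigma> h x
    by (cases h; cases \<sigma>) (auto simp: side_def)
  have side: "(\<lambda>(a, c). (a \<bullet> p < c \<longleftrightarrow> a \<bullet> x < c) \<and> (a \<bullet> p = c \<longleftrightarrow> a \<bullet> x = c)) h
      \<longleftrightarrow> side h x = side h p" for h x p
    by (cases h) (auto simp: side_def)
  show ?thesis unfolding faces_def on_side side
  proof
    assume "F \<in> {F. F \<noteq> {} \<and> (\<exists>\<sigma>. F = {x. \<forall>h\<in>H. side h x = \<sigma> h})}"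
    then obtain \<sigma> p where "F = {x. \<forall>h\<in>H. side h x = \<sigma> h}" "p \<in> F" by blast
    hence "F = {x. \<forall>h\<in>H. side h x = side h p}" by auto
    thus "\<exists>p. F = {x. \<forall>h\<in>H. side h x = side h p}" by blast
  next
    assume "\<exists>p. F = {x. \<forall>h\<in>H. side h x = side h p}"
    then obtain p where "F = {x. \<forall>h\<in>H. side h x = side h p}" by blast
    thus "F \<in> {F. F \<noteq> {} \<and> (\<exists>\<sigma>. F = {x. \<forall>h\<in>H. side h x = \<sigma> h})}"
      by (auto intro: exI[of _ p] exI[of _ "\<lambda>h. side h p"])
  qed
qed

lemma faces_shi_iff:
  fixes F :: "(real^'n::{finite,linorder}) set"
  assumes "m \<ge> 1"
  shows "F \<in> faces (shi_arrangement m) \<longleftrightarrow> (\<exists>p. F = {q. shi_equiv m p q})"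
proof -
  have "(\<forall>(a, c)\<in>shi_arrangement m. (a \<bullet> p < c \<longleftrightarrow> a \<bullet> x < c) \<and> (a \<bullet> p = c \<longleftrightarrow> a \<bullet> x = c)) \<longleftrightarrow>
      shi_equiv m p x" for p x :: "(real, 'n) vec"
  proof -
    have "(\<forall>h\<in>shi_arrangement m. Q h) \<longleftrightarrow> (\<forall>i j s. i < j \<and> s \<in> {- int m + 1..int m} \<longrightarrow>
        Q (axis i 1 - axis j 1, real_of_int s))" for Q :: "(real, 'n) vec \<times> real \<Rightarrow> bool"
      unfolding shi_arrangement_def by blast
    thus ?thesis
      unfolding shi_equiv_iff_hyperplanes[OF assms] by (simp add: inner_diff_left inner_axis')
  qed
  thus ?thesis unfolding faces_iff by simp
qed

text \<open>The tree prescribes the outcome of every comparison in \<open>shi_equiv\<close>, with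
  shift 0 covered by the strict order of the coordinates. Having one point of the tree is then the
  same as knowing all signs.\<close>

lemma tree_point_iff_shi_equiv:
  fixes T :: "'n::{finite,linorder} dtree" and p q :: "real^'n::{finite,linorder}"
  assumes dec: "decorated m T" and m: "m \<ge> 1" and p: "tree_point m T p"
  shows "tree_point m T q \<longleftrightarrow> shi_equiv m p q"
proof
  assume q: "tree_point m T q"
  note P = p[unfolded tree_point_iff[OF dec m]] and Q = q[unfolded tree_point_iff[OF dec m]]
  have less: "p $ i < p $ j \<longleftrightarrow> q $ i < q $ j" for i j using P Q by simp
  show "shi_equiv m p q"
    unfolding shi_equiv_def
  proof (intro allI impI)
    fix i j :: 'n and s assume s: "s \<le> m \<and> (s < m \<or> i < j)"
    show "(p $ j + real s \<le> p $ i \<longleftrightarrow> q $ j + real s \<le> q $ i) \<and>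
        (p $ i = p $ j + real s \<longleftrightarrow> q $ i = q $ j + real s)"
    proof (cases "s = 0")
      case True
      thus ?thesis using less[of i j] less[of j i] by auto
    next
      case False
      hence "1 \<le> s \<and> s \<le> m \<and> (s < m \<or> i < j)" using s by auto
      thus ?thesis using P Q by blast
    qed
  qed
next
  assume eq: "shi_equiv m p q"
  have "q $ i < q $ j \<longleftrightarrow> p $ i < p $ j" for i j
    using eq[unfolded shi_equiv_def, rule_format, of 0 i j] m by auto
  moreover have "(q $ j + real s \<le> q $ i \<longleftrightarrow> p $ j + real s \<le> p $ i) \<and>
      (q $ i = q $ j + real s \<longleftrightarrow> p $ i = p $ j + real s)"
    if "1 \<le> s \<and> s \<le> m \<and> (s < m \<or> i < j)" for i j s
    using eq that unfolding shi_equiv_def by blast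
  ultimately show "tree_point m T q"
    using p unfolding tree_point_iff[OF dec m] by simp
qed

text \<open>Shift \<open>m\<close> from \<open>j\<close> to \<open>i\<close> is visible only if
  \<open>i < j\<close>. For an edge of rank \<open>m\<close> the descent condition supplies such
  labels: the least one of the child and the greatest one of the parent.\<close>

lemma shi_tree_edge_labels:
  assumes T: "T \<in> shi_trees m" and node: "is_node T (v @ [r])"
  obtains i j where "node_of T i = v @ [r]" "node_of T j = v" "r < m \<or> i < j" "r \<le> m"
proof -
  have dec: "decorated m T" and shi: "shi_type m T" using T by (auto simp: shi_trees_def)
  have v: "is_node T v" using node by (rule is_node_snocD)
  have r: "r \<le> m" using is_node_snoc_le decorated_aryD[OF dec] node by blast
  show ?thesis
  proof (cases "r = m")
    case True
    have ne: "label T v \<noteq> {}" "label T (v @ [r]) \<noteq> {}" using dec v node by (auto simp: decorated_def)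
    have "Min (label T (v @ [r])) < Max (label T v)"
      using shi node True by (auto simp: shi_type_def descent_def)
    moreover have "Min (label T (v @ [r])) \<in> label T (v @ [r])" "Max (label T v) \<in> label T v"
      using ne by (auto intro: Min_in Max_in)
    ultimately show ?thesis using that node_of_eqI[OF dec v] node_of_eqI[OF dec node] r by blast
  next
    case False
    obtain i j where "node_of T i = v @ [r]" "node_of T j = v"
      using node_of_surj[OF dec v] node_of_surj[OF dec node] by blast
    thus ?thesis using that False r by simp
  qed
qed

lemma tree_point_eq_iff:
  assumes dec: "decorated m T" and m: "m \<ge> 1" and p: "tree_point m T p"
  shows "p $ i = p $ j \<longleftrightarrow> node_of T i = node_of T j"
proof -
  have *: "p $ i < p $ j \<longleftrightarrow> klt (node_of T i) 0 (node_of T j)" for i j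
    using p unfolding tree_point_iff[OF dec m] by blast
  show ?thesis using *[of i j] *[of j i] not_klt_iff[of "node_of T i" 0 "node_of T j"] by auto
qed

lemma dashed_edge_point:
  assumes T: "T \<in> shi_trees m" and m: "m \<ge> 1" and p: "tree_point m T p" and edge: "dashed_edge T v r"
  obtains i j where "node_of T i = v @ [r]" "node_of T j = v" "r < m \<or> i < j" "1 \<le> r" "r \<le> m"
    "p $ i = p $ j + real r"
proof -
  have dec: "decorated m T" using T by (auto simp: shi_trees_def)
  obtain i j where ij: "node_of T i = v @ [r]" "node_of T j = v" "r < m \<or> i < j" "r \<le> m"
    using shi_tree_edge_labels[OF T dashed_edgeD(2)[OF edge]] .
  have r: "1 \<le> r" using dashed_edgeD(3)[OF edge] by simp
  have "(dstep T)\<^sup>*\<^sup>* v (v @ [r])" using edge by (auto simp: dstep_def)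
  hence "p $ i = p $ j + real r"
    using p ij r unfolding tree_point_iff[OF dec m] by simp
  thus ?thesis using that ij r by blast
qed

section \<open>Dimension\<close>

lemma subspace_constant_on_fibres: "subspace {y :: real^'n. \<forall>i j. c i = c j \<longrightarrow> y $ i = y $ j}"
  (is "subspace ?V")
proof (rule subspaceI)
  show "0 \<in> ?V" by simp
  show "x + y \<in> ?V" if "x \<in> ?V" "y \<in> ?V" for x y
    using that unfolding mem_Collect_eq vector_add_component by metis
  show "a *\<^sub>R x \<in> ?V" if "x \<in> ?V" for a x
    using that unfolding mem_Collect_eq vector_scaleR_component by metis
qed

text \<open>The indicator vectors of the fibres of \<open>c\<close> form an orthogonal
  basis.\<close>

lemma dim_constant_on_fibres:
  fixes c :: "'n::finite \<Rightarrow> 'b"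
  shows "dim {y :: real^'n. \<forall>i j. c i = c j \<longrightarrow> y $ i = y $ j} = card (range c)"
proof -
  define V where "V = {y :: real^'n. \<forall>i j. c i = c j \<longrightarrow> y $ i = y $ j}"
  define \<chi>c :: "'b \<Rightarrow> real^'n" where "\<chi>c a = (\<chi> i. if c i = a then 1 else 0)" for a
  have inj: "inj_on \<chi>c (range c)"
  proof (rule inj_onI)
    fix a b assume "a \<in> range c" and eq: "\<chi>c a = \<chi>c b"
    then obtain i where "c i = a" by blast
    hence "\<chi>c a $ i = 1" by (simp add: \<chi>c_def)
    hence "\<chi>c b $ i = 1" using eq by simp
    thus "a = b" using \<open>c i = a\<close> by (auto simp: \<chi>c_def split: if_splits)
  qed
  have "independent (\<chi>c ` range c)"
  proof (rule pairwise_orthogonal_independent)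
    show "pairwise orthogonal (\<chi>c ` range c)"
      unfolding pairwise_def
    proof (intro ballI impI)
      fix x y assume "x \<in> \<chi>c ` range c" "y \<in> \<chi>c ` range c" "x \<noteq> y"
      then obtain a b where "x = \<chi>c a" "y = \<chi>c b" by blast
      moreover from this have "a \<noteq> b" using \<open>x \<noteq> y\<close> by blast
      ultimately show "orthogonal x y" by (auto simp: orthogonal_def inner_vec_def \<chi>c_def intro: sum.neutral)
    qed
    show "0 \<notin> \<chi>c ` range c"
    proof
      assume "0 \<in> \<chi>c ` range c"
      then obtain i where "\<chi>c (c i) = 0" by auto
      hence "\<chi>c (c i) $ i = 0" by simp
      thus False by (simp add: \<chi>c_def)
    qed
  qed
  moreover have "\<chi>c ` range c \<subseteq> V" by (auto simp: V_def \<chi>c_def)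
  moreover have "V \<subseteq> span (\<chi>c ` range c)"
  proof
    fix y assume y: "y \<in> V"
    have "y = (\<Sum>a\<in>range c. y $ (SOME i. c i = a) *\<^sub>R \<chi>c a)"
    proof (rule vec_eq_iff[THEN iffD2], rule allI)
      fix i
      have "c (SOME k. c k = c i) = c i" by (rule someI[of _ i]) simp
      hence "y $ (SOME k. c k = c i) = y $ i" using y unfolding V_def by blast
      thus "y $ i = (\<Sum>a\<in>range c. y $ (SOME i. c i = a) *\<^sub>R \<chi>c a) $ i"
        by (simp add: \<chi>c_def if_distrib sum.delta cong: if_cong)
    qed
    moreover have "(\<Sum>a\<in>range c. y $ (SOME i. c i = a) *\<^sub>R \<chi>c a) \<in> span (\<chi>c ` range c)"
      by (intro span_sum span_scale span_base) auto
    ultimately show "y \<in> span (\<chi>c ` range c)" by simp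
  qed
  ultimately have "dim V = card (range c)"
    using dim_unique[of "\<chi>c ` range c" V] card_image[OF inj] by blast
  thus ?thesis by (simp add: V_def)
qed

lemma open_Collect_all_finite:
  fixes P :: "'i \<Rightarrow> 'a::topological_space \<Rightarrow> bool"
  assumes "finite I" "\<And>i. i \<in> I \<Longrightarrow> open {x. P i x}"
  shows "open {x. \<forall>i\<in>I. P i x}"
proof -
  have "{x. \<forall>i\<in>I. P i x} = (\<Inter>i\<in>I. {x. P i x})" by auto
  thus ?thesis using open_INT[OF assms(1), of "\<lambda>i. {x. P i x}"] assms(2) by simp
qed

text \<open>The face is \<open>S \<inter> U\<close>, where \<open>S\<close> collects the equations
  valid at \<open>p\<close> and the open set \<open>U\<close> the strict inequalities. The flat
  \<open>S\<close> is the translate by \<open>p\<close> of the space \<open>V\<close> of vectors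
  constant where the free rank is.\<close>

lemma aff_dim_tree_points:
  fixes T :: "'n::{finite,linorder} dtree"
  assumes T: "T \<in> shi_trees m" and m: "m \<ge> 1"
  shows "aff_dim {p. tree_point m T p} = int (card {v. free_node T v})"
proof -
  have dec: "decorated m T" using T by (auto simp: shi_trees_def)
  obtain p where p: "tree_point m T p" using tree_point_exists[OF dec m] by blast
  note P = p[unfolded tree_point_iff[OF dec m]]
  define c where "c i = free_rank T (node_of T i)" for i
  define V where "V = {y :: (real, 'n) vec. \<forall>i j. c i = c j \<longrightarrow> y $ i = y $ j}"
  define I where "I = {(i :: 'n, j, s). s \<le> m \<and> (s < m \<or> i < j)}"
  define U where "U = {q :: (real, 'n) vec. \<forall>(i, j, s)\<in>I.
      (p $ j + real s < p $ i \<longrightarrow> q $ j + real s < q $ i) \<and>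
      (p $ i < p $ j + real s \<longrightarrow> q $ i < q $ j + real s)}"
  define S where "S = {q :: (real, 'n) vec. \<forall>(i, j, s)\<in>I. p $ i = p $ j + real s \<longrightarrow> q $ i = q $ j + real s}"
  have "finite I"
    by (rule finite_subset[of _ "UNIV \<times> UNIV \<times> {..m}"]) (auto simp: I_def)
  have "open U"
    unfolding U_def split_def
    by (intro open_Collect_all_finite \<open>finite I\<close> open_Collect_conj open_Collect_imp
        open_Collect_less closed_Collect_const continuous_intros)
  have F: "{q. tree_point m T q} = S \<inter> U"
  proof -
    have *: "(a \<le> b \<longleftrightarrow> a' \<le> b') \<and> (b = a \<longleftrightarrow> b' = a') \<longleftrightarrow>
        (b = a \<longrightarrow> b' = a') \<and> (a < b \<longrightarrow> a' < b') \<and> (b < a \<longrightarrow> b' < a')" for a b a' b' :: real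
      by auto
    have I: "s \<le> m \<and> (s < m \<or> i < j) \<longleftrightarrow> (i, j, s) \<in> I" for i j s by (simp add: I_def)
    show ?thesis
      unfolding tree_point_iff_shi_equiv[OF dec m p] shi_equiv_def * I S_def U_def by blast
  qed
  have V_S: "S = (+) p ` V"
  proof -
    have "q \<in> S \<longleftrightarrow> q - p \<in> V" for q
    proof
      assume "q - p \<in> V"
      hence "\<forall>i j. c i = c j \<longrightarrow> (q - p) $ i = (q - p) $ j" unfolding V_def by blast
      hence V: "q $ i - p $ i = q $ j - p $ j" if "c i = c j" for i j
        using that by (metis vector_minus_component)
      \<comment> \<open>An equation valid at \<open>p\<close> comes from a common node or from a
        dashed path, and the free rank is constant on both.\<close>
      have "c i = c j" if "(i, j, s) \<in> I" "p $ i = p $ j + real s" for i j s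
      proof (cases "s = 0")
        case True
        thus ?thesis using tree_point_eq_iff[OF dec m p] that by (simp add: c_def)
      next
        case False
        hence "1 \<le> s \<and> s \<le> m \<and> (s < m \<or> i < j)" using that by (auto simp: I_def)
        hence "(dstep T)\<^sup>*\<^sup>* (node_of T j) (node_of T i)" using P that by blast
        thus ?thesis unfolding c_def by (rule free_rank_dpath[symmetric])
      qed
      hence eq: "q $ i = q $ j + real s" if "(i, j, s) \<in> I" "p $ i = p $ j + real s" for i j s
        using V[of i j] that by simp
      show "q \<in> S" using eq unfolding S_def by blast
    next
      assume q: "q \<in> S"
      have same: "(q - p) $ i = (q - p) $ j" if "node_of T i = node_of T j" for i j
      proof -
        have "(i, j, 0) \<in> I" "p $ i = p $ j + real 0"
          using that m tree_point_eq_iff[OF dec m p] by (auto simp: I_def)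
        hence "q $ i = q $ j + real 0" using q unfolding S_def by blast
        thus ?thesis using \<open>p $ i = p $ j + real 0\<close> by simp
      qed
      \<comment> \<open>A whole path may have rank above \<open>m\<close> or ends with labels in the
        wrong order, so hyperplanes are used edge by edge. Different labels of one node are linked
        by shift 0.\<close>
      have path: "\<forall>i j. node_of T j = v \<longrightarrow> node_of T i = w \<longrightarrow> (q - p) $ i = (q - p) $ j"
        if "(dstep T)\<^sup>*\<^sup>* v w" for v w
        using that
      proof (induction rule: rtranclp_induct)
        case base
        thus ?case using same by metis
      next
        case (step y z)
        obtain r where r: "z = y @ [r]" "dashed_edge T y r" using step by (auto simp: dstep_def)
        obtain i j where "node_of T i = z" "node_of T j = y" "r < m \<or> i < j" "r \<le> m"
            and "p $ i = p $ j + real r"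
          using dashed_edge_point[OF T m p r(2)] r(1) by metis
        moreover from this have "(i, j, r) \<in> I" by (simp add: I_def)
        ultimately have ij: "node_of T i = z" "node_of T j = y" "(i, j, r) \<in> I" "p $ i = p $ j + real r"
          by blast+
        hence "q $ i = q $ j + real r" using q unfolding S_def by blast
        hence "(q - p) $ i = (q - p) $ j" using ij by simp
        thus ?case using step.IH ij same by metis
      qed
      have "(q - p) $ i = (q - p) $ j" if "c i = c j" for i j
      proof -
        have "(dstep T)\<^sup>*\<^sup>* (node_of T i) (node_of T j) \<or> (dstep T)\<^sup>*\<^sup>* (node_of T j) (node_of T i)"
          using that free_rank_eq_iff node_of_props(1)[OF dec] unfolding c_def by blast
        thus ?thesis using path by metis
      qed
      thus "q - p \<in> V" unfolding V_def by blast
    qed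
    moreover have "(\<exists>y\<in>V. q = p + y) \<longleftrightarrow> q - p \<in> V" for q
      by (metis add_diff_cancel_left' diff_add_cancel add.commute)
    ultimately show ?thesis by (auto simp: image_iff)
  qed
  have sub: "subspace V" unfolding V_def by (rule subspace_constant_on_fibres)
  have "p \<in> S \<inter> U" using p F by blast
  moreover have "convex S" unfolding V_S using sub by (intro convex_translation subspace_imp_convex)
  \<comment> \<open>Intersecting a convex set with an open set that meets it keeps the affine
    dimension; \<open>p\<close> is the common point.\<close>
  ultimately have "aff_dim (S \<inter> U) = aff_dim S"
    using aff_dim_convex_Int_open[OF _ \<open>open U\<close>] by blast
  also have "\<dots> = aff_dim V" unfolding V_S by (rule aff_dim_translation_eq)
  also have "\<dots> = int (dim V)" using sub by (rule aff_dim_subspace)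
  also have "dim V = card (range c)" unfolding V_def by (rule dim_constant_on_fibres)
  also have "range c = free_rank T ` {v. is_node T v}"
    using node_of_props(1)[OF dec] node_of_surj[OF dec] unfolding c_def by (auto simp: image_iff) metis
  also have "card \<dots> = card {v. free_node T v}" by (rule card_free_rank_image)
  finally show ?thesis using F by simp
qed

section \<open>Recovering the tree from a point\<close>

text \<open>The admissible placements of \<open>q\<close> as a child of \<open>q'\<close> of rank
  \<open>s\<close>. Values are related rather than indices, since equal coordinates share a node;
  for \<open>s = m\<close> any pair of indices with these values may make the inequality
  visible.\<close>

definition candidate :: "nat \<Rightarrow> real^'n::{finite,linorder} \<Rightarrow> real \<Rightarrow> nat \<Rightarrow> real \<Rightarrow> bool" where
  "candidate m p q' s q \<longleftrightarrow> q' < q \<and> q' + real s \<le> q \<and> s \<le> m \<and>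
     (s < m \<or> (\<exists>i j. p $ i = q \<and> p $ j = q' \<and> i < j))"

lemma candidate_0: "m \<ge> 1 \<Longrightarrow> q' < q \<Longrightarrow> candidate m p q' 0 q"
  by (simp add: candidate_def)

text \<open>The visible pair of indices need not be \<open>i\<close> and \<open>j\<close>, but
  indices with equal coordinates lie in the same node.\<close>

lemma tree_point_candidate:
  assumes dec: "decorated m T" and m: "m \<ge> 1" and p: "tree_point m T p"
    and cand: "candidate m p (p $ j) s (p $ i)"
  shows "vleq (node_of T j @ [s]) (node_of T i)"
proof -
  note P = p[unfolded tree_point_iff[OF dec m]]
  have "klt (node_of T j) (int s) (node_of T i)"
  proof (cases "s = 0")
    case True
    thus ?thesis using P cand by (simp add: candidate_def)
  next
    case False
    obtain i' j' where ij: "p $ i' = p $ i" "p $ j' = p $ j" "s < m \<or> i' < j'"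
      using cand unfolding candidate_def by blast
    have "1 \<le> s \<and> s \<le> m \<and> (s < m \<or> i' < j')" using False cand ij by (auto simp: candidate_def)
    moreover have "p $ j' + real s \<le> p $ i'" using ij cand by (simp add: candidate_def)
    ultimately have "klt (node_of T j') (int s) (node_of T i')" using P by blast
    thus ?thesis using ij tree_point_eq_iff[OF dec m p] by metis
  qed
  thus ?thesis by (simp add: vleq_snoc_iff)
qed

text \<open>The word \<open>v @ [s]\<close> comes after \<open>K v + s\<close>, which forces the
  inequality between the coordinates; for \<open>s = m\<close> the descent condition makes it
  visible.\<close>

lemma tree_point_parent_candidate:
  assumes T: "T \<in> shi_trees m" and m: "m \<ge> 1" and p: "tree_point m T p"
    and ne: "node_of T i \<noteq> []"
  shows "\<exists>j s. node_of T i = node_of T j @ [s] \<and> candidate m p (p $ j) s (p $ i)"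
proof -
  have dec: "decorated m T" using T by (simp add: shi_trees_def)
  note P = p[unfolded tree_point_iff[OF dec m]]
  obtain v s where v: "node_of T i = v @ [s]" using ne by (metis rev_exhaust)
  obtain i' j where ij: "node_of T i' = v @ [s]" "node_of T j = v" "s < m \<or> i' < j" "s \<le> m"
    using shi_tree_edge_labels[OF T] node_of_props(1)[OF dec, of i] v by metis
  have i': "p $ i' = p $ i" using ij v tree_point_eq_iff[OF dec m p] by simp
  have klt: "klt (node_of T j) (int s) (node_of T i')" using klt_snoc ij by simp
  hence "klt (node_of T j) 0 (node_of T i')" using klt_mono by fastforce
  hence less: "p $ j < p $ i'" using P by blast
  have "p $ j + real s \<le> p $ i'"
  proof (cases "s = 0")
    case False
    hence "1 \<le> s \<and> s \<le> m \<and> (s < m \<or> i' < j)" using ij by simp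
    thus ?thesis using P klt by blast
  qed (use less in simp)
  hence "candidate m p (p $ j) s (p $ i)"
    unfolding candidate_def using less i' ij by metis
  thus ?thesis using v ij by blast
qed

text \<open>The parent in \<open>T\<close> has a smaller coordinate, hence the same word in
  \<open>T'\<close>, and \<open>T'\<close> places \<open>i\<close> no earlier than any candidate
  child.\<close>

lemma node_of_vleq:
  fixes p :: "real^'n::{finite,linorder}"
  assumes T: "T \<in> shi_trees m" "T' \<in> shi_trees m" and m: "m \<ge> 1"
    and p: "tree_point m T p" "tree_point m T' p"
    and IH: "\<And>j. p $ j < p $ i \<Longrightarrow> node_of T j = node_of T' j"
  shows "vleq (node_of T i) (node_of T' i)"
proof (cases "node_of T i = []")
  case True
  thus ?thesis by (cases "node_of T' i") (auto simp: vleq_def vless_iff_klt klt_def)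
next
  case False
  have dec: "decorated m T'" using T by (simp add: shi_trees_def)
  obtain j s where js: "node_of T i = node_of T j @ [s]" "candidate m p (p $ j) s (p $ i)"
    using tree_point_parent_candidate[OF T(1) m p(1) False] by blast
  hence "node_of T j = node_of T' j" using IH by (simp add: candidate_def)
  thus ?thesis using tree_point_candidate[OF dec m p(2) js(2)] js(1) by simp
qed

text \<open>Induction on the number of smaller coordinates; exchanging the two trees in
  \<open>node_of_vleq\<close> gives the opposite inequality.\<close>

lemma node_of_unique:
  fixes p :: "real^'n::{finite,linorder}"
  assumes "T \<in> shi_trees m" "T' \<in> shi_trees m" "m \<ge> 1" "tree_point m T p" "tree_point m T' p"
  shows "node_of T i = node_of T' i"
proof (induction "card {k. p $ k < p $ i}" arbitrary: i rule: less_induct)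
  case less
  have "node_of T j = node_of T' j" if "p $ j < p $ i" for j
  proof (rule less)
    have "{k. p $ k < p $ j} \<subset> {k. p $ k < p $ i}" using that by auto
    thus "card {k. p $ k < p $ j} < card {k. p $ k < p $ i}" by (intro psubset_card_mono) auto
  qed
  thus ?case
    using node_of_vleq[of T m T' p i] node_of_vleq[of T' m T p i] assms vleq_antisym by metis
qed

section \<open>Uniqueness of the tree from its words, labels and dashed edges\<close>

definition dashed_flag :: "'a dtree \<Rightarrow> vertex \<Rightarrow> bool" where
  "dashed_flag T v \<longleftrightarrow> (\<exists>A ts. subtree T v = Some (Node A True ts))"

lemma dtree_eqI:
  assumes "ary_tree k T" "ary_tree k T'" "\<And>v. is_node T v \<longleftrightarrow> is_node T' v"
    "\<And>v. is_node T v \<Longrightarrow> label T v = label T' v"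
    "\<And>v. is_node T v \<Longrightarrow> dashed_flag T v \<longleftrightarrow> dashed_flag T' v"
  shows "T = T'"
  using assms
proof (induction T arbitrary: T')
  case Leaf
  have "\<not> is_node T' []" using Leaf.prems(3)[of "[]"] by (auto simp: is_node_def)
  thus ?case by (cases T') (auto simp: is_node_def)
next
  case (Node A d ts)
  have nd: "is_node (Node A d ts) []" by (simp add: is_node_def)
  hence "is_node T' []" using Node.prems(3) by blast
  then obtain A' d' ts' where T': "T' = Node A' d' ts'" by (auto simp: is_node_def)
  have "A = A'" using Node.prems(4)[OF nd] T' by (simp add: label_def)
  moreover have "d = d'" using Node.prems(5)[OF nd] T' by (cases d; cases d') (auto simp: dashed_flag_def)
  moreover have "ts = ts'"
  proof (rule nth_equalityI)
    have "length ts = k" "length ts' = k"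
      using Node.prems(1,2) T' unfolding ary_tree_def by (metis subtree.simps(1))+
    thus len: "length ts = length ts'" by simp
    fix r assume r: "r < length ts"
    have sub: "subtree (Node A d ts) (r # v) = subtree (ts ! r) v"
        "subtree T' (r # v) = subtree (ts' ! r) v" for v
      using r len T' by auto
    show "ts ! r = ts' ! r"
    proof (rule Node.IH)
      show "ts ! r \<in> set ts" using r by simp
      show "ary_tree k (ts ! r)" "ary_tree k (ts' ! r)"
        using Node.prems(1,2) sub unfolding ary_tree_def by metis+
      show "is_node (ts ! r) v \<longleftrightarrow> is_node (ts' ! r) v" for v
        using Node.prems(3)[of "r # v"] sub[of v] unfolding is_node_def by metis
      show "label (ts ! r) v = label (ts' ! r) v" if "is_node (ts ! r) v" for v
        using Node.prems(4)[of "r # v"] sub[of v] that unfolding is_node_def label_def by metis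
      show "dashed_flag (ts ! r) v \<longleftrightarrow> dashed_flag (ts' ! r) v" if "is_node (ts ! r) v" for v
        using Node.prems(5)[of "r # v"] sub[of v] that unfolding is_node_def dashed_flag_def by metis
    qed
  qed
  ultimately show ?case using T' by simp
qed

lemma dashed_edge_transfer:
  assumes T: "T \<in> shi_trees m" "T' \<in> shi_trees m" and m: "m \<ge> 1"
    and p: "tree_point m T p" "tree_point m T' p" and edge: "dashed_edge T v r"
  shows "dashed_edge T' v r"
proof -
  have dec: "decorated m T'" using T by (simp add: shi_trees_def)
  obtain i j where ij: "node_of T i = v @ [r]" "node_of T j = v" "r < m \<or> i < j" "1 \<le> r" "r \<le> m"
      "p $ i = p $ j + real r"
    using dashed_edge_point[OF T(1) m p(1) edge] .
  hence nodes: "node_of T' i = v @ [r]" "node_of T' j = v"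
    using node_of_unique[OF T m p] by simp_all
  have "(dstep T')\<^sup>*\<^sup>* (node_of T' j) (node_of T' i)"
    using p(2)[unfolded tree_point_iff[OF dec m]] ij(3-6) by blast
  hence "(dstep T')\<^sup>*\<^sup>* v (v @ [r])" using nodes by simp
  \<comment> \<open>The path is not empty, and an edge ending at \<open>v @ [r]\<close> can only
    start at \<open>v\<close>.\<close>
  then obtain u where "dstep T' u (v @ [r])" by (cases rule: rtranclp.cases) auto
  thus ?thesis by (auto simp: dstep_def)
qed

lemma dashed_flag_iff:
  assumes "decorated m T"
  shows "dashed_flag T v \<longleftrightarrow> (\<exists>r. dashed_edge T v r)"
  using assms unfolding dashed_flag_def decorated_def dashed_edge_def by blast

lemma label_eq_node_of:
  assumes "decorated m T" "is_node T v"
  shows "label T v = {i. node_of T i = v}"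
  using node_of_eqI[OF assms] node_of_props(2)[OF assms(1)] by blast

lemma tree_point_unique:
  fixes p :: "real^'n::{finite,linorder}"
  assumes T: "T \<in> shi_trees m" "T' \<in> shi_trees m" and m: "m \<ge> 1"
    and p: "tree_point m T p" "tree_point m T' p"
  shows "T = T'"
proof (rule dtree_eqI)
  have dec: "decorated m T" "decorated m T'" using T by (auto simp: shi_trees_def)
  note nodes = node_of_unique[OF T m p]
  show "ary_tree (m + 1) T" "ary_tree (m + 1) T'" using dec by (auto simp: decorated_def)
  show *: "is_node T v \<longleftrightarrow> is_node T' v" for v
    using node_of_surj[OF dec(1), of v] node_of_surj[OF dec(2), of v]
      node_of_props(1)[OF dec(1)] node_of_props(1)[OF dec(2)] nodes by metis
  show "label T v = label T' v" if "is_node T v" for v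
    using label_eq_node_of[OF dec(1)] label_eq_node_of[OF dec(2)] that * nodes by simp
  show "dashed_flag T v \<longleftrightarrow> dashed_flag T' v" for v
    unfolding dashed_flag_iff[OF dec(1)] dashed_flag_iff[OF dec(2)]
    using dashed_edge_transfer[OF T m p] dashed_edge_transfer[OF T(2,1) m p(2,1)] by blast
qed

section \<open>The tree of a point\<close>

text \<open>The number \<open>f\<close> bounds the depth of the tree; it only serves termination.\<close>

fun build :: "vertex set \<Rightarrow> (vertex \<Rightarrow> 'a set) \<Rightarrow> (vertex \<Rightarrow> bool) \<Rightarrow> nat \<Rightarrow> nat \<Rightarrow> vertex \<Rightarrow> 'a dtree" where
  "build N lab fl k 0 v = Leaf"
| "build N lab fl k (Suc f) v =
     (if v \<in> N then Node (lab v) (fl v) (map (\<lambda>r. build N lab fl k f (v @ [r])) [0..<k]) else Leaf)"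

lemma subtree_buildD:
  "subtree (build N lab fl k f u) x = Some (Node A d ts) \<Longrightarrow>
     u @ x \<in> N \<and> A = lab (u @ x) \<and> d = fl (u @ x) \<and> length ts = k"
proof (induction f arbitrary: u x)
  case 0
  thus ?case by (cases x) auto
next
  case (Suc f)
  show ?case
  proof (cases x)
    case Nil
    thus ?thesis using Suc.prems by (auto split: if_splits)
  next
    case (Cons r y)
    hence "u \<in> N" "r < k" "subtree (build N lab fl k f (u @ [r])) y = Some (Node A d ts)"
      using Suc.prems by (auto split: if_splits)
    thus ?thesis using Suc.IH[of "u @ [r]" y] Cons by simp
  qed
qed

lemma is_node_build:
  assumes closed: "\<And>v r. v @ [r] \<in> N \<Longrightarrow> v \<in> N \<and> r < k"
  shows "u @ x \<in> N \<Longrightarrow> length x < f \<Longrightarrow> is_node (build N lab fl k f u) x"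
proof (induction f arbitrary: u x)
  case (Suc f)
  have pre: "v @ y \<in> N \<Longrightarrow> v \<in> N" for v y
  proof (induction y rule: rev_induct)
    case (snoc a y)
    thus ?case using closed[of "v @ y" a] by simp
  qed simp
  have u: "u \<in> N" using pre Suc.prems by blast
  show ?case
  proof (cases x)
    case Nil
    thus ?thesis using u by (simp add: is_node_def)
  next
    case (Cons r y)
    hence "u @ [r] \<in> N" using pre[of "u @ [r]" y] Suc.prems by simp
    hence "r < k" using closed by blast
    moreover have "is_node (build N lab fl k f (u @ [r])) y" using Suc Cons by simp
    ultimately show ?thesis using u Cons by (simp add: is_node_def)
  qed
qed simp

text \<open>Values are added in increasing order. As parents have smaller values, a new value
  affects no earlier word, and it receives the largest of its finitely many candidate words.\<close>

lemma greedy_words_exist: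
  fixes A :: "real set" and R :: "real \<Rightarrow> nat \<Rightarrow> real \<Rightarrow> bool"
  assumes R: "\<And>q' s q. R q' s q \<Longrightarrow> q' < q \<and> s \<le> m" and "finite A"
  shows "\<exists>W. \<forall>q\<in>A. (W q \<noteq> [] \<longrightarrow> (\<exists>q'\<in>A. \<exists>s. R q' s q \<and> W q = W q' @ [s])) \<and>
     (\<forall>q'\<in>A. \<forall>s. R q' s q \<longrightarrow> vleq (W q' @ [s]) (W q))"
  using \<open>finite A\<close>
proof (induction rule: finite_linorder_max_induct)
  case (insert b A)
  then obtain W where W: "\<forall>q\<in>A. (W q \<noteq> [] \<longrightarrow> (\<exists>q'\<in>A. \<exists>s. R q' s q \<and> W q = W q' @ [s])) \<and>
     (\<forall>q'\<in>A. \<forall>s. R q' s q \<longrightarrow> vleq (W q' @ [s]) (W q))" by blast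
  define C where "C = {W q' @ [s] |q' s. q' \<in> A \<and> R q' s b}"
  have "C \<subseteq> (\<lambda>(q', s). W q' @ [s]) ` (A \<times> {..m})" using R by (auto simp: C_def)
  hence finC: "finite C" by (rule finite_subset) (use \<open>finite A\<close> in auto)
  \<comment> \<open>Without candidates the value goes to the root, the empty word.\<close>
  obtain x where x: "x \<noteq> [] \<longrightarrow> x \<in> C" "\<forall>y\<in>C. vleq y x"
  proof (cases "C = {}")
    case False
    thus ?thesis using finite_vleq_max[OF finC] that by blast
  qed (use that[of "[]"] in auto)
  define W' where "W' = W(b := x)"
  have old: "W' q = W q" if "q \<in> A" for q using insert.hyps that by (auto simp: W'_def)
  have b: "W' b = x" by (simp add: W'_def)
  have bR: "\<not> R b s q" if "q \<in> insert b A" for q s using R[of b s q] insert.hyps that by force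
  show ?case
  proof (rule exI[of _ W'], rule ballI)
    fix q assume q: "q \<in> insert b A"
    show "(W' q \<noteq> [] \<longrightarrow> (\<exists>q'\<in>insert b A. \<exists>s. R q' s q \<and> W' q = W' q' @ [s])) \<and>
        (\<forall>q'\<in>insert b A. \<forall>s. R q' s q \<longrightarrow> vleq (W' q' @ [s]) (W' q))"
    proof (cases "q = b")
      case True
      have "\<exists>q'\<in>insert b A. \<exists>s. R q' s b \<and> x = W' q' @ [s]" if "x \<noteq> []"
        using x(1) that old unfolding C_def by auto
      moreover have "vleq (W' q' @ [s]) x" if "q' \<in> insert b A" "R q' s b" for q' s
      proof -
        have "q' \<in> A" using that bR by auto
        thus ?thesis using x(2) old that unfolding C_def by auto
      qed
      ultimately show ?thesis unfolding True b by blast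
    next
      case False
      hence qA: "q \<in> A" using q by simp
      hence "\<exists>q'\<in>insert b A. \<exists>s. R q' s q \<and> W' q = W' q' @ [s]" if "W' q \<noteq> []"
        using W old that by (metis insertCI)
      moreover have "vleq (W' q' @ [s]) (W' q)" if "q' \<in> insert b A" "R q' s q" for q' s
      proof -
        have "q' \<in> A" using that bR q by auto
        thus ?thesis using W old that qA by simp
      qed
      ultimately show ?thesis by blast
    qed
  qed
qed simp

section \<open>Comparisons between greedy words\<close>

locale greedy_words =
  fixes m :: nat and p :: "real^'n::{finite,linorder}" and W :: "real \<Rightarrow> vertex"
  assumes m: "m \<ge> 1"
    and word_parent: "\<And>i. W (p $ i) \<noteq> [] \<Longrightarrow>
      \<exists>j s. candidate m p (p $ j) s (p $ i) \<and> W (p $ i) = W (p $ j) @ [s]"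
    and word_max: "\<And>i j s. candidate m p (p $ j) s (p $ i) \<Longrightarrow> vleq (W (p $ j) @ [s]) (W (p $ i))"
begin

definition word :: "'n \<Rightarrow> vertex" where
  "word i = W (p $ i)"

lemma candidate_klt: "candidate m p (p $ j) s (p $ i) \<Longrightarrow> klt (word j) (int s) (word i)"
  using word_max by (simp add: vleq_snoc_iff word_def)

lemma word_less: "p $ j < p $ i \<Longrightarrow> klt (word j) 0 (word i)"
  using candidate_klt[of j 0 i] candidate_0[OF m, of "p $ j" "p $ i" p] by simp

lemma word_less_iff: "p $ j < p $ i \<longleftrightarrow> klt (word j) 0 (word i)"
proof
  assume klt: "klt (word j) 0 (word i)"
  show "p $ j < p $ i"
  proof (rule ccontr)
    assume "\<not> ?thesis"
    then consider "p $ i < p $ j" | "p $ i = p $ j" by linarith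
    thus False
    proof cases
      case 1
      thus ?thesis using word_less[OF 1] klt not_klt_iff[of "word i" 0 "word j"] by simp
    next
      case 2
      thus ?thesis using klt by (simp add: word_def)
    qed
  qed
qed (rule word_less)

lemma word_eq_iff: "word i = word j \<longleftrightarrow> p $ i = p $ j"
  using word_less_iff[of i j] word_less_iff[of j i] klt_self[of "word i" 0]
  by (metis less_irrefl linorder_neqE_linordered_idom word_def)

lemma word_cases:
  obtains "word i = []" | e r where "candidate m p (p $ e) r (p $ i)" "word i = word e @ [r]"
  using word_parent[of i] unfolding word_def by blast

text \<open>
  Placing words greedily never moves a node past an event that it precedes, even if the comparison
  (for \<open>s = m\<close>) is not visible to the arrangement. This is what the induction needs, because the
  parent of \<open>i\<close> need not be comparable with the event when \<open>i\<close> is.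
\<close>

lemma word_before_event:
  "1 \<le> s \<Longrightarrow> s \<le> m \<Longrightarrow> p $ i < p $ j + real s \<Longrightarrow> klt (word i) (- int s) (word j)"
proof (induction "length (word i)" arbitrary: i s rule: less_induct)
  case less
  show ?case
  proof (cases rule: word_cases[of i])
    case 1
    thus ?thesis using less.prems by (simp add: klt_def)
  next
    case (2 e r)
    have le: "p $ e + real r \<le> p $ i" "r \<le> m" using 2 by (auto simp: candidate_def)
    \<comment> \<open>From \<open>p $ e + real r \<le> p $ i\<close> the parent inherits the strict
      inequality with shift \<open>s - r\<close>. If \<open>s \<le> r\<close>, the shift
      \<open>r - s\<close> is below \<open>m\<close>, so \<open>e\<close> is a candidate parent of
      \<open>j\<close>; otherwise the induction hypothesis applies to \<open>e\<close>.\<close>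
    have "klt (word e) (int r - int s) (word j)"
    proof (cases "s \<le> r")
      case True
      hence "candidate m p (p $ e) (r - s) (p $ j)"
        using le less.prems by (auto simp: candidate_def of_nat_diff)
      from candidate_klt[OF this] show ?thesis using True by (simp add: of_nat_diff)
    next
      case False
      have "klt (word e) (- int (s - r)) (word j)"
        using 2 False less.prems le by (intro less.hyps) (auto simp: of_nat_diff)
      thus ?thesis using False by (simp add: of_nat_diff)
    qed
    thus ?thesis using klt_snoc_left[of "word e" r s "word j"] less.prems 2 by simp
  qed
qed

lemma event_le_iff:
  assumes s: "1 \<le> s" "s \<le> m" "s < m \<or> i < j"
  shows "p $ j + real s \<le> p $ i \<longleftrightarrow> klt (word j) (int s) (word i)"
proof
  assume le: "p $ j + real s \<le> p $ i"
  hence "candidate m p (p $ j) s (p $ i)" using s by (auto simp: candidate_def)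
  thus "klt (word j) (int s) (word i)" by (rule candidate_klt)
next
  assume klt: "klt (word j) (int s) (word i)"
  show "p $ j + real s \<le> p $ i"
  proof (rule ccontr)
    assume "\<not> ?thesis"
    hence "klt (word i) (- int s) (word j)" using word_before_event s by simp
    thus False using klt not_klt_iff[of "word j" "int s" "word i"] by simp
  qed
qed

section \<open>The tree on the greedy words\<close>

definition dashed :: "vertex \<Rightarrow> nat \<Rightarrow> bool" where
  "dashed v r \<longleftrightarrow> r \<ge> 1 \<and> (\<exists>i j. word j = v \<and> word i = v @ [r] \<and> p $ i = p $ j + real r)"

text \<open>The depth bound is one more than the greatest word length, because a node at depth
  \<open>l\<close> requires a bound above \<open>l\<close>.\<close>

definition point_tree :: "'n dtree" where
  "point_tree = build (range word) (\<lambda>v. {i. word i = v}) (\<lambda>v. \<exists>r. dashed v r) (m + 1)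
     (Suc (Max (length ` range word))) []"

lemma word_closed: "v @ [r] \<in> range word \<Longrightarrow> v \<in> range word \<and> r < m + 1"
proof -
  assume "v @ [r] \<in> range word"
  then obtain i where i: "word i = v @ [r]" by force
  show ?thesis
    by (cases rule: word_cases[of i]) (use i in \<open>auto simp: candidate_def\<close>)
qed

lemma is_node_point_tree: "is_node point_tree v \<longleftrightarrow> v \<in> range word"
proof
  assume "is_node point_tree v"
  thus "v \<in> range word" unfolding is_node_def point_tree_def using subtree_buildD by fastforce
next
  assume v: "v \<in> range word"
  hence "length v < Suc (Max (length ` range word))" by (intro le_imp_less_Suc Max_ge) auto
  moreover have "[] @ v \<in> range word" using v by simp
  ultimately show "is_node point_tree v"
    unfolding point_tree_def by (intro is_node_build[OF word_closed])
qed

lemma subtree_point_treeD: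
  "subtree point_tree v = Some (Node A d ts) \<Longrightarrow>
     A = {i. word i = v} \<and> (d \<longleftrightarrow> (\<exists>r. dashed v r)) \<and> length ts = m + 1"
  unfolding point_tree_def using subtree_buildD by fastforce

lemma label_point_tree: "v \<in> range word \<Longrightarrow> label point_tree v = {i. word i = v}"
  using is_node_point_tree[of v] subtree_point_treeD[of v] by (auto simp: is_node_def label_def)

text \<open>Suppose \<open>v\<close> had a node child \<open>k\<close> of rank
  \<open>r' > r\<close>. The equation for \<open>i\<close> makes \<open>i\<close> a candidate parent
  of \<open>k\<close> with rank \<open>r' - r\<close>, which is below \<open>m\<close>. Then
  \<open>k\<close> belongs after \<open>v @ [r]\<close> shifted by \<open>r' - r\<close>, but
  \<open>v @ [r']\<close> comes before it.\<close>

lemma dashed_is_cadet: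
  assumes "dashed v r"
  shows "is_cadet point_tree v r"
proof -
  obtain i j where ij: "r \<ge> 1" "word j = v" "word i = v @ [r]" "p $ i = p $ j + real r"
    using assms by (auto simp: dashed_def)
  have "\<not> is_node point_tree (v @ [r'])" if r': "r' > r" for r'
  proof
    assume "is_node point_tree (v @ [r'])"
    then obtain k where k: "word k = v @ [r']" by (force simp: is_node_point_tree)
    show False
    proof (cases rule: word_cases[of k])
      case (2 e s)
      hence "s = r'" "p $ e = p $ j" using k ij word_eq_iff[of e j] by auto
      hence "candidate m p (p $ i) (r' - r) (p $ k)"
        using 2 ij r' by (auto simp: candidate_def of_nat_diff)
      from candidate_klt[OF this] show False using ij k r' by (simp add: klt_def of_nat_diff)
    qed (use k in auto)
  qed
  moreover have "is_node point_tree (v @ [r])" using ij by (metis is_node_point_tree rangeI)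
  ultimately show ?thesis using ij by (auto simp: is_cadet_def)
qed

lemma dashed_edge_point_tree: "dashed_edge point_tree v r \<longleftrightarrow> dashed v r"
proof
  assume edge: "dashed_edge point_tree v r"
  then obtain r' where r': "dashed v r'"
    using subtree_point_treeD[of v _ True] by (force simp: dashed_edge_def)
  have "is_cadet point_tree v r" using edge by (simp add: dashed_edge_def)
  hence "r = r'" using dashed_is_cadet[OF r'] unfolding is_cadet_def by (meson linorder_neqE_nat)
  thus "dashed v r" using r' by simp
next
  assume d: "dashed v r"
  hence cadet: "is_cadet point_tree v r" by (rule dashed_is_cadet)
  have "v \<in> range word" using d by (auto simp: dashed_def)
  then obtain A d' ts where sub: "subtree point_tree v = Some (Node A d' ts)"
    using is_node_point_tree[of v] by (auto simp: is_node_def)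
  hence d' using subtree_point_treeD d by blast
  thus "dashed_edge point_tree v r" using cadet sub by (auto simp: dashed_edge_def)
qed

lemma decorated_point_tree: "decorated m point_tree"
  unfolding decorated_def
proof (intro conjI allI impI)
  show "ary_tree (m + 1) point_tree" unfolding ary_tree_def using subtree_point_treeD by blast
  show "label point_tree v \<noteq> {}" if "is_node point_tree v" for v
    using that label_point_tree by (auto simp: is_node_point_tree)
  show "label point_tree v \<inter> label point_tree w = {}"
    if "is_node point_tree v \<and> is_node point_tree w \<and> v \<noteq> w" for v w
    using that label_point_tree by (auto simp: is_node_point_tree)
  show "(\<Union>v\<in>{v. is_node point_tree v}. label point_tree v) = UNIV"
    using label_point_tree by (auto simp: is_node_point_tree)
  show "\<exists>r. is_cadet point_tree v r" if "subtree point_tree v = Some (Node A True ts)" for v A ts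
    using subtree_point_treeD[OF that] dashed_is_cadet by blast
qed

lemma node_of_point_tree: "node_of point_tree i = word i"
  using decorated_point_tree
  by (rule node_of_eqI) (auto simp: is_node_point_tree label_point_tree)

text \<open>A child of rank \<open>m\<close> was placed through a visible inequality, whose indices
  \<open>i < j\<close> witness the descent.\<close>

lemma shi_type_point_tree: "shi_type m point_tree"
  unfolding shi_type_def
proof (intro allI impI)
  fix v assume "is_node point_tree (v @ [m])"
  then obtain k where k: "word k = v @ [m]" by (force simp: is_node_point_tree)
  show "descent point_tree v m"
  proof (cases rule: word_cases[of k])
    case (2 e s)
    hence "candidate m p (p $ e) m (p $ k)" and e: "word e = v" using k by auto
    then obtain i j where ij: "p $ i = p $ k" "p $ j = p $ e" "i < j" by (auto simp: candidate_def)
    hence "word i = v @ [m]" "word j = v" using k e by (auto simp: word_def)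
    moreover have "l \<in> label point_tree (word l)" for l by (simp add: label_point_tree)
    ultimately have "i \<in> label point_tree (v @ [m])" "j \<in> label point_tree v" by metis+
    hence "Min (label point_tree (v @ [m])) \<le> i" "j \<le> Max (label point_tree v)" by auto
    thus ?thesis using ij unfolding descent_def by order
  qed (use k in auto)
qed

text \<open>The equations of the dashed edges telescope, with equal words standing for equal
  coordinates.\<close>

lemma dpath_diff:
  "(dstep point_tree)\<^sup>*\<^sup>* v w \<Longrightarrow> word j = v \<Longrightarrow>
     \<exists>i. word i = w \<and> p $ i + real (sum_list v) = p $ j + real (sum_list w)"
proof (induction rule: rtranclp_induct)
  case (step y z)
  then obtain k where k: "word k = y" "p $ k + real (sum_list v) = p $ j + real (sum_list y)" by blast
  obtain r where r: "z = y @ [r]" "dashed y r"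
    using step.hyps dashed_edge_point_tree by (auto simp: dstep_def)
  then obtain i j' where ij: "word j' = y" "word i = z" "p $ i = p $ j' + real r"
    by (auto simp: dashed_def)
  hence "p $ j' = p $ k" using k word_eq_iff by metis
  hence "p $ i + real (sum_list v) = p $ j + real (sum_list z)" using ij k r by simp
  thus ?case using ij by blast
qed auto

text \<open>The edge from the parent \<open>e\<close> to \<open>i\<close> is tight and therefore
  dashed. Subtracting its rank leaves the same situation for \<open>e\<close> with shift
  \<open>s - r\<close>, until \<open>e\<close> is the node of \<open>j\<close>.\<close>

lemma event_eq_dpath:
  "candidate m p (p $ j) s (p $ i) \<Longrightarrow> 1 \<le> s \<Longrightarrow> p $ i = p $ j + real s \<Longrightarrow>
     (dstep point_tree)\<^sup>*\<^sup>* (word j) (word i) \<and> sum_list (word i) = sum_list (word j) + s"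
proof (induction "length (word i)" arbitrary: i s rule: less_induct)
  case less
  have s: "s \<le> m" using less.prems by (simp add: candidate_def)
  have klt: "klt (word j) (int s) (word i)" using less.prems candidate_klt by blast
  show ?case
  proof (cases rule: word_cases[of i])
    case 1
    thus ?thesis using klt by (simp add: klt_def)
  next
    case (2 e r)
    have e: "p $ e < p $ i" "p $ e + real r \<le> p $ i" "r \<le> m" using 2 by (auto simp: candidate_def)
    \<comment> \<open>Otherwise appending \<open>r\<close> would put \<open>K (word i) - s\<close>
      before \<open>K (word j)\<close>, against the placement of \<open>i\<close> after
      \<open>K (word j) + s\<close>.\<close>
    have not: "\<not> klt (word e) (int r - int s) (word j)"
    proof
      assume "klt (word e) (int r - int s) (word j)"
      hence "klt (word i) (- int s) (word j)"
        using klt_snoc_left[of "word e" r s "word j"] less.prems 2 by simp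
      thus False using klt not_klt_iff[of "word j" "int s" "word i"] by simp
    qed
    \<comment> \<open>A slack edge would put the value of \<open>e\<close> shifted by
      \<open>r - s\<close> strictly below that of \<open>j\<close>, and the words would follow,
      contrary to \<open>not\<close>.\<close>
    have eq: "p $ e + real r = p $ i"
    proof (rule ccontr)
      assume "\<not> ?thesis"
      hence lt: "p $ e + real r < p $ j + real s" using e less.prems by simp
      show False
      proof (cases "s \<le> r")
        case True
        hence "candidate m p (p $ e) (r - s) (p $ j)"
          using lt e less.prems by (auto simp: candidate_def of_nat_diff)
        from candidate_klt[OF this] show False using not True by (simp add: of_nat_diff)
      next
        case False
        hence "klt (word e) (- int (s - r)) (word j)"
          using lt s by (intro word_before_event) (auto simp: of_nat_diff)
        thus False using not False by (simp add: of_nat_diff)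
      qed
    qed
    have r: "r \<ge> 1" using eq e by (cases r) auto
    hence "dashed (word e) r" using eq 2 unfolding dashed_def by metis
    hence step: "dstep point_tree (word e) (word i)"
      using 2 by (auto simp: dstep_def dashed_edge_point_tree)
    consider "s < r" | "s = r" | "s > r" by linarith
    thus ?thesis
    proof cases
      case 1
      hence "candidate m p (p $ e) (r - s) (p $ j)"
        using eq e less.prems by (auto simp: candidate_def of_nat_diff)
      from candidate_klt[OF this] show ?thesis using not 1 by (simp add: of_nat_diff)
    next
      case 2
      hence "word e = word j" using eq less.prems word_eq_iff by simp
      thus ?thesis using step 2 \<open>word i = word e @ [r]\<close> by auto
    next
      case 3
      have "(dstep point_tree)\<^sup>*\<^sup>* (word j) (word e) \<and> sum_list (word e) = sum_list (word j) + (s - r)"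
      proof (rule less.hyps)
        show "length (word e) < length (word i)" using 2 by simp
        show "1 \<le> s - r" using 3 by simp
        show "p $ e = p $ j + real (s - r)" using eq less.prems 3 by (simp add: of_nat_diff)
        \<comment> \<open>Since \<open>r \<ge> 1\<close>, the shift \<open>s - r\<close> is below
          \<open>m\<close> and visible for every pair of indices.\<close>
        thus "candidate m p (p $ j) (s - r) (p $ e)" using 3 r s by (auto simp: candidate_def)
      qed
      thus ?thesis using step 2 3 by auto
    qed
  qed
qed

lemma tree_point_point_tree: "tree_point m point_tree p"
  unfolding tree_point_iff[OF decorated_point_tree m] node_of_point_tree
proof (intro conjI allI impI)
  show "p $ i < p $ j \<longleftrightarrow> klt (word i) 0 (word j)" for i j by (rule word_less_iff)
next
  fix i j :: 'n and s assume s: "1 \<le> s \<and> s \<le> m \<and> (s < m \<or> i < j)"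
  show "p $ j + real s \<le> p $ i \<longleftrightarrow> klt (word j) (int s) (word i)" using event_le_iff s by blast
  show "p $ i = p $ j + real s \<longleftrightarrow>
      (dstep point_tree)\<^sup>*\<^sup>* (word j) (word i) \<and> sum_list (word i) = sum_list (word j) + s"
  proof
    assume eq: "p $ i = p $ j + real s"
    hence "candidate m p (p $ j) s (p $ i)" using s by (auto simp: candidate_def)
    thus "(dstep point_tree)\<^sup>*\<^sup>* (word j) (word i) \<and> sum_list (word i) = sum_list (word j) + s"
      using event_eq_dpath eq s by blast
  next
    assume *: "(dstep point_tree)\<^sup>*\<^sup>* (word j) (word i) \<and> sum_list (word i) = sum_list (word j) + s"
    then obtain k where "word k = word i"
        "p $ k + real (sum_list (word j)) = p $ j + real (sum_list (word i))"
      using dpath_diff by blast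
    thus "p $ i = p $ j + real s" using * word_eq_iff[of k i] by simp
  qed
qed

end

section \<open>The bijection and the dimension\<close>

lemma shi_tree_exists:
  fixes p :: "real^'n::{finite,linorder}"
  assumes m: "m \<ge> 1"
  shows "\<exists>T\<in>shi_trees m. tree_point m T p"
proof -
  have "\<exists>W. \<forall>q\<in>range (($) p).
     (W q \<noteq> [] \<longrightarrow> (\<exists>q'\<in>range (($) p). \<exists>s. candidate m p q' s q \<and> W q = W q' @ [s])) \<and>
     (\<forall>q'\<in>range (($) p). \<forall>s. candidate m p q' s q \<longrightarrow> vleq (W q' @ [s]) (W q))"
    by (rule greedy_words_exist[where m = m]) (auto simp: candidate_def)
  then obtain W where W: "\<forall>q\<in>range (($) p).
     (W q \<noteq> [] \<longrightarrow> (\<exists>q'\<in>range (($) p). \<exists>s. candidate m p q' s q \<and> W q = W q' @ [s])) \<and>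
     (\<forall>q'\<in>range (($) p). \<forall>s. candidate m p q' s q \<longrightarrow> vleq (W q' @ [s]) (W q))" ..
  interpret greedy_words m p W
  proof
    show "m \<ge> 1" by (rule m)
    show "\<exists>j s. candidate m p (p $ j) s (p $ i) \<and> W (p $ i) = W (p $ j) @ [s]" if "W (p $ i) \<noteq> []" for i
      using W that by fastforce
    show "vleq (W (p $ j) @ [s]) (W (p $ i))" if "candidate m p (p $ j) s (p $ i)" for i j s
      using W that by blast
  qed
  show ?thesis
    using tree_point_point_tree decorated_point_tree shi_type_point_tree
    by (auto simp: shi_trees_def)
qed

theorem theorem2p22:
  fixes m :: nat
  assumes "m \<ge> 1"
  shows "(\<forall>T \<in> (shi_trees m :: 'n::{finite,linorder} dtree set).
            \<exists>!F. F \<in> faces (shi_arrangement m :: ((real^'n::{finite,linorder}) \<times> real) set) \<and>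
                 (\<forall>p. p \<in> F \<longleftrightarrow> tree_point m T p)) \<and>
         bij_betw (Psi m) (shi_trees m :: 'n::{finite,linorder} dtree set)
            (faces (shi_arrangement m :: ((real^'n::{finite,linorder}) \<times> real) set)) \<and>
         (\<forall>T \<in> (shi_trees m :: 'n::{finite,linorder} dtree set). \<forall>k::nat.
            card {v. free_node T v} = k \<longleftrightarrow> aff_dim (Psi m T) = int k)"
proof -
  have face: "{p. tree_point m T p} \<in> faces (shi_arrangement m)"
    if T: "T \<in> shi_trees m" for T :: "'n dtree"
  proof -
    have dec: "decorated m T" using T by (simp add: shi_trees_def)
    obtain p where "tree_point m T p" using tree_point_exists[OF dec assms] by blast
    thus ?thesis
      using tree_point_iff_shi_equiv[OF dec assms] faces_shi_iff[OF assms] by blast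
  qed
  have unique: "\<exists>!F. F \<in> faces (shi_arrangement m) \<and> (\<forall>p. p \<in> F \<longleftrightarrow> tree_point m T p)"
    if "T \<in> shi_trees m" for T :: "'n dtree"
    using face[OF that] by (intro ex1I[of _ "{p. tree_point m T p}"]) auto
  have Psi: "Psi m T = {p. tree_point m T p}" if "T \<in> shi_trees m" for T :: "'n dtree"
    unfolding Psi_def using face[OF that] by (intro the_equality) auto
  have "bij_betw (Psi m) (shi_trees m :: 'n dtree set) (faces (shi_arrangement m))"
    unfolding bij_betw_def
  proof (intro conjI inj_onI equalityI subsetI)
    fix T T' :: "'n dtree"
    assume T: "T \<in> shi_trees m" "T' \<in> shi_trees m" and eq: "Psi m T = Psi m T'"
    \<comment> \<open>Faces of trees are nonempty, so equal faces share a point, and a point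
      determines its tree.\<close>
    obtain p where "tree_point m T p"
      using tree_point_exists[OF _ assms, of T] T by (auto simp: shi_trees_def)
    moreover from this have "tree_point m T' p" using eq Psi T by blast
    ultimately show "T = T'" using tree_point_unique[OF T assms] by blast
  next
    fix F assume "F \<in> Psi m ` (shi_trees m :: 'n dtree set)"
    thus "F \<in> faces (shi_arrangement m)" using face Psi by auto
  next
    fix F :: "(real, 'n) vec set" assume "F \<in> faces (shi_arrangement m)"
    then obtain p where F: "F = {q. shi_equiv m p q}" using faces_shi_iff[OF assms] by blast
    obtain T where T: "T \<in> shi_trees m" "tree_point m T p" using shi_tree_exists[OF assms] by blast
    hence "decorated m T" by (simp add: shi_trees_def)
    \<comment> \<open>A tree with one point of \<open>F\<close> has exactly the points with the same
      signs, which make up \<open>F\<close>.\<close>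
    from tree_point_iff_shi_equiv[OF this assms T(2)] have "Psi m T = F"
      using Psi[OF T(1)] F by simp
    thus "F \<in> Psi m ` shi_trees m" using T(1) by blast
  qed
  moreover have "card {v. free_node T v} = k \<longleftrightarrow> aff_dim (Psi m T) = int k"
    if "T \<in> shi_trees m" for T :: "'n dtree" and k
    unfolding Psi[OF that] aff_dim_tree_points[OF that assms] by simp
  ultimately show ?thesis using unique by blast
qed

end
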